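(* Let $n\ge1$. For any $\chi>24$ and any $\kappa_b\ge1$, there exist a constant $\kappa_s>0$, a time-varying network $\{\mathcal G^k\}_{k=1}^\infty$ on $m$ nodes (for some $m$) with a corresponding sequence of gossip matrices $\{W(k)\}_{k=1}^\infty$ satisfying the gossip assumption with constant $\chi$ (see context), and functions $f_{ij}:(\ell_2)^n\to\mathbb R$, $i=1,\dots,m$, $j=1,\dots,n$, with $F_i=\frac1n\sum_{j=1}^nf_{ij}$, such that: (a) each $f_{ij}$ is convex and $L_{ij}$-smooth, each $F_i$ is $\mu_i$-strongly convex and $L_i$-smooth, and for all $i$: $\kappa_b\ge L_i/\mu_i$ and $\kappa_s\ge\frac1n\sum_{j=1}^nL_{ij}/\mu_i$; (b) the problem $\min_x\sum_{i=1}^mF_i(x)$ has a solution of the form $(x^*,\dots,x^* )\in(\ell_2)^n$ with $x^*\in\ell_2$, and for any first-order decentralized algorithm (see context) started from $x^0=0$, $$\frac1{nm}\sum_{i=1}^m\sum_{j=1}^n\frac{\|x_{ij}-x^*\|^2}{\|x_{ij}^0-x^*\|^2}\ge\max\{T_1,T_2\},$$ where $$T_1=\left(1-\frac{2}{\sqrt{\frac23\kappa_b+\frac13}+1}\right)^{2+16N_c/(\chi-24)},\qquad T_2=\left(1-\frac{2n}{\sqrt n\sqrt{\frac23\kappa_s+n/3}+n}\right)^{4N_s/n}.$$ Here $N_c$ is the number of communication iterations performed, $N_s$ is the maximum over nodes of the number of stochastic oracle calls performed on a node, $x_i=(x_{i1},\dots,x_{in})\in(\ell_2)^n$ is any vector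 in the local memory $\mathcal H_i(k)$ of node $i$ at the last time step $k$, and $x^0_{ij}=0$ are the blocks of the initial points.
   Context: Definitions. $g$ is $\ell$-smooth if $\|\nabla g(u)-\nabla g(v)\|\le\ell\|u-v\|$, and $\mu$-strongly convex if $g(v)\ge g(u)+\langle\nabla g(u),v-u\rangle+\frac\mu2\|v-u\|^2$. Gossip assumption with constant $\chi\ge1$: for every $k$ (with $E$ the space on which the problem is posed): (1) $[W(k)]_{ij}\ne0$ iff $(i,j)$ is an edge of $\mathcal G^k$ or $i=j$; (2) $\ker W(k)\supset\{(c,\dots,c):c\in\mathbb R\}$; (3) $\mathrm{range}\,W(k)\subset\{a\in\mathbb R^m:\sum_ia_i=0\}$; (4) $\|(W(k)\otimes I)x-x\|^2\le(1-\chi^{-1})\|x\|^2$ for all $x\in E^m$ with $\sum_ix_i=0$. First-order decentralized algorithm: time is discrete, and each step is either communicational or computational. Node $i$ has local memory $\mathcal H_i(k)$ at step $k$, with $\mathcal H_i(0)=\{0\}$. If step $k$ is computational, $\mathcal H_i(k+1)\subseteq\mathrm{span}\big(\bigcup_{j=1}^n\{x,\nabla f_{ij}(x),\nabla f_{ij}^*(x):x\in\mathcal H_i(k)\}\big)$ for all $i$, where $f^*$ is the convex conjugate. If step $k$ is communicational, $\mathcal H_i(k+1)\subseteq\mathrm{span}\big(\bigcup_{j\in\mathcal N_i^k}\mathcal H_j(k)\cup\mathcal H_i(k)\big)$, where $\mathcal N_i^k$ is the set of neighbours of $i$ in $\mathcal G^k$; the graph changes with the communicational steps, one graph of the sequence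 per communicational step. A stochastic oracle call on node $i$ is one evaluation of $\nabla f_{ij}$ or $\nabla f_{ij}^*$ for a single index $j$ at a single point. *)

theory Defs
  imports
    "HOL-Analysis.Analysis"
    "HOL-Library.Extended_Nat"
    "Graph_Theory.Pair_Digraph"
begin

typedef ell2 = "{x :: nat \<Rightarrow> real. summable (\<lambda>i. (x i)\<^sup>2)}"
  morphisms ell2_nth Abs_ell2
  by (rule exI[of _ "\<lambda>_. 0"]) simp

setup_lifting type_definition_ell2

lemma summable_ell2_power2: "summable (\<lambda>i. (ell2_nth x i)\<^sup>2)"
  using ell2_nth[of x] by simp

lemma square_summable_mult:
  fixes x y :: "nat \<Rightarrow> real"
  assumes "summable (\<lambda>i. (x i)\<^sup>2)" "summable (\<lambda>i. (y i)\<^sup>2)"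
  shows "summable (\<lambda>i. x i * y i)"
proof (rule summable_comparison_test')
  show "summable (\<lambda>i. (x i)\<^sup>2 + (y i)\<^sup>2)"
    by (rule summable_add[OF assms])
next
  fix i :: nat
  have "2 * \<bar>x i\<bar> * \<bar>y i\<bar> \<le> (x i)\<^sup>2 + (y i)\<^sup>2"
    using sum_squares_bound[of "\<bar>x i\<bar>" "\<bar>y i\<bar>"] by simp
  moreover have "0 \<le> \<bar>x i\<bar> * \<bar>y i\<bar>" by simp
  ultimately show "norm (x i * y i) \<le> (x i)\<^sup>2 + (y i)\<^sup>2"
    by (simp only: real_norm_def abs_mult)
qed

lemma square_summable_add:
  fixes x y :: "nat \<Rightarrow> real"
  assumes "summable (\<lambda>i. (x i)\<^sup>2)" "summable (\<lambda>i. (y i)\<^sup>2)"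
  shows "summable (\<lambda>i. (x i + y i)\<^sup>2)"
proof -
  have "summable (\<lambda>i. (x i)\<^sup>2 + (y i)\<^sup>2 + 2 * (x i * y i))"
    by (intro summable_add summable_mult assms square_summable_mult)
  then show ?thesis
    by (simp add: power2_sum mult.assoc)
qed

lemma square_summable_scale:
  fixes x :: "nat \<Rightarrow> real"
  assumes "summable (\<lambda>i. (x i)\<^sup>2)"
  shows "summable (\<lambda>i. (c * x i)\<^sup>2)"
  using summable_mult[OF assms, of "c\<^sup>2"] by (simp add: power_mult_distrib)

instantiation ell2 :: real_vector
begin

lift_definition zero_ell2 :: ell2 is "\<lambda>_. 0" by simp

lift_definition plus_ell2 :: "ell2 \<Rightarrow> ell2 \<Rightarrow> ell2" is "\<lambda>x y i. x i + y i"
  by (rule square_summable_add)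

lift_definition scaleR_ell2 :: "real \<Rightarrow> ell2 \<Rightarrow> ell2" is "\<lambda>c x i. c * x i"
  by (rule square_summable_scale)

lift_definition uminus_ell2 :: "ell2 \<Rightarrow> ell2" is "\<lambda>x i. - x i" by simp

lift_definition minus_ell2 :: "ell2 \<Rightarrow> ell2 \<Rightarrow> ell2" is "\<lambda>x y i. x i - y i"
  using square_summable_add[of _ "\<lambda>i. - y i" for y] by force

lemmas ell2_nth_simps = zero_ell2.rep_eq plus_ell2.rep_eq scaleR_ell2.rep_eq
  uminus_ell2.rep_eq minus_ell2.rep_eq

instance
proof
  fix x y z :: ell2 and a b :: real
  show "x + y + z = x + (y + z)" "x + y = y + x" "0 + x = x" "- x + x = 0" "x - y = x + - y"
    "a *\<^sub>R (x + y) = a *\<^sub>R x + a *\<^sub>R y" "(a + b) *\<^sub>R x = a *\<^sub>R x + b *\<^sub>R x"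
    "a *\<^sub>R b *\<^sub>R x = (a * b) *\<^sub>R x" "1 *\<^sub>R x = x"
    by (simp_all add: ell2_nth_inject[symmetric] ell2_nth_simps fun_eq_iff algebra_simps)
qed

end

instantiation ell2 :: real_inner
begin

definition inner_ell2 :: "ell2 \<Rightarrow> ell2 \<Rightarrow> real"
  where "inner_ell2 x y = (\<Sum>i. ell2_nth x i * ell2_nth y i)"

definition norm_ell2 :: "ell2 \<Rightarrow> real"
  where "norm_ell2 x = sqrt (inner x x)"

definition sgn_ell2 :: "ell2 \<Rightarrow> ell2"
  where "sgn_ell2 x = x /\<^sub>R norm x"

definition dist_ell2 :: "ell2 \<Rightarrow> ell2 \<Rightarrow> real"
  where "dist_ell2 x y = norm (x - y)"

definition uniformity_ell2 :: "(ell2 \<times> ell2) filter"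
  where "uniformity_ell2 = (INF e\<in>{0<..}. principal {(x, y). dist x y < e})"

definition open_ell2 :: "ell2 set \<Rightarrow> bool"
  where "open_ell2 U = (\<forall>x\<in>U. \<forall>\<^sub>F (x', y) in uniformity. x' = x \<longrightarrow> y \<in> U)"

instance
proof
  fix x y z :: ell2 and r :: real
  have prod: "summable (\<lambda>i. ell2_nth u i * ell2_nth v i)" for u v
    by (intro square_summable_mult summable_ell2_power2)
  show "dist x y = norm (x - y)" by (rule dist_ell2_def)
  show "sgn x = x /\<^sub>R norm x" by (rule sgn_ell2_def)
  show "uniformity = (INF e\<in>{0<..}. principal {(x, y :: ell2). dist x y < e})"
    by (rule uniformity_ell2_def)
  show "open U = (\<forall>x\<in>U. \<forall>\<^sub>F (x', y) in uniformity. x' = x \<longrightarrow> y \<in> U)" for U :: "ell2 set"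
    by (rule open_ell2_def)
  show "inner x y = inner y x" by (simp add: inner_ell2_def mult.commute)
  show "inner (x + y) z = inner x z + inner y z"
    by (simp add: inner_ell2_def ell2_nth_simps distrib_right suminf_add prod)
  show "inner (r *\<^sub>R x) y = r * inner x y"
    by (simp add: inner_ell2_def ell2_nth_simps mult.assoc suminf_mult prod)
  show "0 \<le> inner x x" unfolding inner_ell2_def by (intro suminf_nonneg prod) simp
  show "inner x x = 0 \<longleftrightarrow> x = 0"
  proof -
    have "inner x x = 0 \<longleftrightarrow> (\<forall>i. ell2_nth x i * ell2_nth x i = 0)"
      unfolding inner_ell2_def by (rule suminf_eq_zero_iff[OF prod]) simp
    then show ?thesis
      by (simp add: ell2_nth_inject[symmetric] ell2_nth_simps fun_eq_iff)
  qed
  show "norm x = sqrt (inner x x)" by (rule norm_ell2_def)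
qed

end

definition smooth_with :: "real \<Rightarrow> ('e::real_inner \<Rightarrow> real) \<Rightarrow> bool"
  where "smooth_with l g \<longleftrightarrow>
    (\<exists>dg. (\<forall>u. GDERIV g u :> dg u) \<and> (\<forall>u v. norm (dg u - dg v) \<le> l * norm (u - v)))"

definition strongly_convex :: "real \<Rightarrow> ('e::real_inner \<Rightarrow> real) \<Rightarrow> bool"
  where "strongly_convex \<mu> g \<longleftrightarrow>
    (\<exists>dg. (\<forall>u. GDERIV g u :> dg u) \<and>
      (\<forall>u v. g v \<ge> g u + inner (dg u) (v - u) + \<mu> / 2 * (norm (v - u))\<^sup>2))"

definition convex_conjugate :: "('e::real_inner \<Rightarrow> real) \<Rightarrow> 'e \<Rightarrow> ereal"
  where "convex_conjugate g y = (SUP x. ereal (inner y x - g x))"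

text \<open>The conjugate may be infinite; it has a gradient at \<open>y\<close> only if it is finite near \<open>y\<close>.\<close>

definition has_conjugate_gradient :: "('e::real_inner \<Rightarrow> real) \<Rightarrow> 'e \<Rightarrow> 'e \<Rightarrow> bool"
  where "has_conjugate_gradient g y d \<longleftrightarrow>
    (\<forall>\<^sub>F z in nhds y. \<bar>convex_conjugate g z\<bar> \<noteq> \<infinity>) \<and>
    GDERIV (\<lambda>z. real_of_ereal (convex_conjugate g z)) y :> d"

text \<open>
  The nodes are \<open>1, \<dots>, m\<close>; the network is indexed by \<open>k \<ge> 1\<close>, so values at \<open>k = 0\<close> and
  entries of \<open>W k\<close> outside \<open>{1..m}\<close> are irrelevant. A \<^const>\<open>pair_graph\<close> is a finite loopfree
  digraph with a symmetric arc relation, that is, a finite simple undirected graph.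
\<close>

definition time_varying_network :: "nat \<Rightarrow> (nat \<Rightarrow> nat pair_pre_digraph) \<Rightarrow> bool"
  where "time_varying_network m G \<longleftrightarrow>
    (\<forall>k\<ge>1. pair_graph (G k) \<and> pverts (G k) = {1..m})"

text \<open>The type argument is the space \<open>E\<close>; \<open>E\<^sup>m\<close> carries the Hilbert sum norm.\<close>

definition gossip_assumption ::
  "'e::real_inner itself \<Rightarrow> real \<Rightarrow> nat \<Rightarrow> (nat \<Rightarrow> nat pair_pre_digraph) \<Rightarrow>
    (nat \<Rightarrow> nat \<Rightarrow> nat \<Rightarrow> real) \<Rightarrow> bool"
  where "gossip_assumption E chi m G W \<longleftrightarrow> (\<forall>k\<ge>1.
    (\<forall>i\<in>{1..m}. \<forall>j\<in>{1..m}. W k i j \<noteq> 0 \<longleftrightarrow> (i, j) \<in> parcs (G k) \<or> i = j) \<and>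
    (\<forall>c::real. \<forall>i\<in>{1..m}. (\<Sum>j\<in>{1..m}. W k i j * c) = 0) \<and>
    (\<forall>a::nat \<Rightarrow> real. (\<Sum>i\<in>{1..m}. \<Sum>j\<in>{1..m}. W k i j * a j) = 0) \<and>
    (\<forall>x::nat \<Rightarrow> 'e. (\<Sum>i\<in>{1..m}. x i) = 0 \<longrightarrow>
      (\<Sum>i\<in>{1..m}. (norm ((\<Sum>j\<in>{1..m}. W k i j *\<^sub>R x j) - x i))\<^sup>2)
        \<le> (1 - 1 / chi) * (\<Sum>i\<in>{1..m}. (norm (x i))\<^sup>2)))"

datatype oracle_kind = Primal | Dual

text \<open>A call \<open>(q, j, x)\<close> evaluates the gradient of the \<open>j\<close>-th summand or of its conjugate at \<open>x\<close>.\<close>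

type_synonym ('j, 'e) oracle_call = "oracle_kind \<times> 'j \<times> 'e"

text \<open>The answer is a singleton, or empty if the requested gradient does not exist.\<close>

fun oracle_answer :: "('j \<Rightarrow> 'e::real_inner \<Rightarrow> real) \<Rightarrow> ('j, 'e) oracle_call \<Rightarrow> 'e set"
  where
    "oracle_answer g (Primal, j, x) = {d. GDERIV (g j) x :> d}"
  | "oracle_answer g (Dual, j, x) = {d. has_conjugate_gradient (g j) x d}"

definition communications :: "(nat \<Rightarrow> bool) \<Rightarrow> nat \<Rightarrow> nat"
  where "communications comm k = card {t. t < k \<and> comm t}"

text \<open>
  A run of \<open>K\<close> steps: \<open>comm k\<close> says that step \<open>k\<close> is communicational, \<open>H i k\<close> is the memory of
  node \<open>i\<close> at step \<open>k\<close>, and \<open>Q i k\<close> is the set of calls (gradient evaluations) made by node \<open>i\<close> in a computational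
  step \<open>k\<close>. As \<open>Q i k\<close> may be infinite (for instance all calls at points of \<open>H i k\<close>), this
  allows every memory inclusion \<open>H i (k+1) \<subseteq> span \<dots>\<close> over all points of \<open>H i k\<close> and all \<open>j\<close>.
  The \<open>r\<close>-th communicational step (\<open>r \<ge> 1\<close>) uses the graph \<open>G r\<close>.
\<close>

definition first_order_decentralized ::
  "nat \<Rightarrow> (nat \<Rightarrow> nat pair_pre_digraph) \<Rightarrow> (nat \<Rightarrow> 'j \<Rightarrow> 'e::real_inner \<Rightarrow> real) \<Rightarrow>
    nat \<Rightarrow> (nat \<Rightarrow> bool) \<Rightarrow> (nat \<Rightarrow> nat \<Rightarrow> ('j, 'e) oracle_call set) \<Rightarrow>
    (nat \<Rightarrow> nat \<Rightarrow> 'e set) \<Rightarrow> bool"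
  where "first_order_decentralized m G f K comm Q H \<longleftrightarrow>
    (\<forall>i\<in>{1..m}. H i 0 = {0}) \<and>
    (\<forall>k<K. \<forall>i\<in>{1..m}.
      if comm k
      then H i (Suc k) \<subseteq>
        span ((\<Union>j\<in>{j. (i, j) \<in> parcs (G (Suc (communications comm k)))}. H j k) \<union> H i k)
      else (\<forall>(q, j, x)\<in>Q i k. x \<in> H i k) \<and>
        H i (Suc k) \<subseteq> span (H i k \<union> (\<Union>c\<in>Q i k. oracle_answer (f i) c)))"

definition ecard :: "'a set \<Rightarrow> enat"
  where "ecard A = (if finite A then enat (card A) else \<infinity>)"

definition max_oracle_calls ::
  "nat \<Rightarrow> nat \<Rightarrow> (nat \<Rightarrow> bool) \<Rightarrow> (nat \<Rightarrow> nat \<Rightarrow> ('j, 'e) oracle_call set) \<Rightarrow> enat"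
  where "max_oracle_calls m K comm Q =
    Max ((\<lambda>i. \<Sum>k | k < K \<and> \<not> comm k. ecard (Q i k)) ` {1..m})"

definition rate1 :: "real \<Rightarrow> real"
  where "rate1 \<kappa> = 1 - 2 / (sqrt (2 / 3 * \<kappa> + 1 / 3) + 1)"

definition rate2 :: "nat \<Rightarrow> real \<Rightarrow> real"
  where "rate2 n \<kappa> =
    1 - 2 * real n / (sqrt (real n) * sqrt (2 / 3 * \<kappa> + real n / 3) + real n)"

text \<open>
  \<open>rate2 n \<kappa>\<close> is nonnegative iff \<open>\<kappa> \<ge> n\<close>; only then do its real powers below have their
  usual meaning.
\<close>

definition bound1 :: "real \<Rightarrow> real \<Rightarrow> nat \<Rightarrow> real"
  where "bound1 chi \<kappa> Nc = rate1 \<kappa> powr (2 + 16 * real Nc / (chi - 24))"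

text \<open>
  The case \<open>s = 0\<close> is split off because \<open>0 powr 0 = 0\<close>, while the zeroth power is meant to be 1.
  For infinitely many calls the bound is the limit of the finite case, as \<open>rate2 n \<kappa> < 1\<close>.
\<close>

definition bound2 :: "nat \<Rightarrow> real \<Rightarrow> enat \<Rightarrow> real"
  where "bound2 n \<kappa> Ns = (case Ns of
      enat s \<Rightarrow> (if s = 0 then 1 else rate2 n \<kappa> powr (4 * real s / real n))
    | \<infinity> \<Rightarrow> 0)"

definition mean_relative_error ::
  "nat \<Rightarrow> (nat \<Rightarrow> 'h::real_normed_vector ^ 'n) \<Rightarrow> (nat \<Rightarrow> 'h ^ 'n) \<Rightarrow> 'h \<Rightarrow> real"
  where "mean_relative_error m x0 x xs =
    1 / (real CARD('n) * real m) *
      (\<Sum>i\<in>{1..m}. \<Sum>j\<in>UNIV. (norm (x i $ j - xs))\<^sup>2 / (norm (x0 i $ j - xs))\<^sup>2)"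

definition local_objective :: "('n::finite \<Rightarrow> 'e \<Rightarrow> real) \<Rightarrow> 'e \<Rightarrow> real"
  where "local_objective g x = 1 / real CARD('n) * (\<Sum>j\<in>UNIV. g j x)"

end

theory Submission
  imports Defs
begin

text \<open>
  The hard problem is a chain. In every block the minimizer is the geometric sequence
  \<open>1, q, q\<^sup>2, \<dots>\<close> with \<open>q = rate1 \<kappa>b\<close>, and a point whose block entries vanish from coordinate
  \<open>k\<close> on has relative squared error at least \<open>q ^ (2 * k)\<close>
  (\<open>relative_error_geometric\<close>). So it suffices to bound how fast nonzero coordinates can appear.

  The chain is split between two nodes. Node 1 holds a linear term at coordinate 0 and the couplings
  \<open>(y\<^sub>1 - y\<^sub>2)\<^sup>2, (y\<^sub>3 - y\<^sub>4)\<^sup>2, \<dots>\<close>; node 2 holds \<open>(y\<^sub>0 - y\<^sub>1)\<^sup>2, (y\<^sub>2 - y\<^sub>3)\<^sup>2, \<dots>\<close>. Hence node 1 can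
  only advance a support of even length and node 2 one of odd length, in each case by one
  coordinate. The reason covers the primal and the conjugate oracle alike: if no pair of a node is
  separated by the end of the support, flipping the sign of all later coordinates is a symmetry of
  the summand, hence of its conjugate, and the gradient of a function at a fixed point of a
  symmetry is itself fixed (\<open>oracle_answer_reflection_fixed\<close>, \<open>oracle_answer_blocked\<close>). The remaining
  \<open>p\<close> nodes hold multiples of \<open>(norm y)\<^sup>2\<close> with total convexity constant 1; with
  constants 1 at nodes 1 and 2 and coupling strength \<open>\<kappa>b - 1\<close>, the recurrence for the minimizer
  has the root \<open>q\<close> (\<open>rate1_equation\<close>, \<open>node_gradients_cancel\<close>).

  Communication bound: the graph is a star on \<open>p + 2\<close> nodes whose hub rotates through the \<open>p\<close>
  nodes other than 1 and 2. In a star a leaf receives only what the hub already had, so information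
  spreads to one new node per round, and passing between nodes 1 and 2 takes at least \<open>p\<close>
  rounds (\<open>level_step\<close>, \<open>memory_level\<close>). After \<open>r\<close> rounds at most \<open>1 + r div p\<close> coordinates are
  known. The Laplacian divided by \<open>p + 2\<close> contracts with factor \<open>1 - 1 / (p + 2)\<close>, so
  \<open>p = \<lceil>(chi - 24) / 8\<rceil>\<close> respects the gossip assumption and gives the exponent of \<open>bound1\<close>.

  Oracle bound: the summand \<open>j\<close> at a node acts on block \<open>j\<close> alone, with factor \<open>n\<close>, so \<open>n * \<kappa>b\<close> is
  an admissible \<open>\<kappa>s\<close>, and \<open>rate2 n (n * \<kappa>b) = rate1 \<kappa>b\<close>. Each call on node 1 or 2 extends the support of
  one block by at most one coordinate, so the supports of all blocks together have length at most
  twice the maximal number of calls per node (\<open>memory_calls\<close>). By convexity the mean over the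
  blocks is smallest when the calls are spread evenly (\<open>bound2_le\<close>).
\<close>

section \<open>Reflections and oracle answers\<close>

lemma GDERIV_unique:
  assumes "GDERIV f x :> a" "GDERIV f x :> b"
  shows "a = b"
proof -
  have "(\<lambda>h. inner h a) = (\<lambda>h. inner h b)"
    using assms unfolding gderiv_def by (rule has_derivative_unique)
  then have "inner (a - b) a = inner (a - b) b" by (rule fun_cong)
  then have "inner (a - b) (a - b) = 0" by (simp add: inner_diff_right)
  then show ?thesis by simp
qed

definition reflection :: "('e::real_inner \<Rightarrow> 'e) \<Rightarrow> bool"
  where "reflection R \<longleftrightarrow>
    linear R \<and> (\<forall>x. R (R x) = x) \<and> (\<forall>x y. inner (R x) y = inner x (R y))"

lemma norm_reflection:
  assumes "reflection R"
  shows "norm (R x) = norm x"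
  using assms by (simp add: reflection_def norm_eq_sqrt_inner)

lemma bounded_linear_reflection:
  assumes "reflection R"
  shows "bounded_linear R"
proof (rule bounded_linear_intro[where K = 1])
  show "R (x + y) = R x + R y" "R (r *\<^sub>R x) = r *\<^sub>R R x" for x y r
    using assms by (simp_all add: reflection_def linear_add linear_scale)
qed (simp add: norm_reflection[OF assms])

text \<open>
  By the chain rule, \<open>R d\<close> is also a gradient of \<open>f \<circ> R = f\<close> at \<open>R x = x\<close>.
\<close>

lemma GDERIV_reflection_fixed:
  assumes R: "reflection R" and inv: "\<And>y. f (R y) = f y"
    and fixed: "R x = x" and d: "GDERIV f x :> d"
  shows "R d = d"
proof -
  have "FDERIV R x :> R"
    by (rule bounded_linear_imp_has_derivative[OF bounded_linear_reflection[OF R]])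
  moreover have "FDERIV f (R x) :> (\<lambda>h. inner h d)"
    using d fixed by (simp add: gderiv_def)
  ultimately have "FDERIV (\<lambda>y. f (R y)) x :> (\<lambda>h. inner (R h) d)"
    by (rule has_derivative_compose)
  moreover have "inner (R h) d = inner h (R d)" for h
    using R by (simp add: reflection_def)
  ultimately have "GDERIV f x :> R d"
    by (simp add: gderiv_def inv)
  then show ?thesis using d by (rule GDERIV_unique)
qed

lemma convex_conjugate_reflection:
  assumes R: "reflection R" and inv: "\<And>y. f (R y) = f y"
  shows "convex_conjugate f (R y) = convex_conjugate f y"
proof -
  have "surj R" using R by (metis reflection_def surjI)
  have "convex_conjugate f (R y) = (SUP x. ereal (inner y (R x) - f (R x)))"
    using R by (simp add: convex_conjugate_def inv reflection_def)
  also have "\<dots> = (SUP x\<in>range R. ereal (inner y x - f x))"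
    by (simp add: image_image)
  also have "\<dots> = convex_conjugate f y"
    by (simp add: \<open>surj R\<close> convex_conjugate_def)
  finally show ?thesis .
qed

text \<open>
  A symmetry of a summand is a symmetry of its conjugate, so it constrains the answers of both
  oracles at once. This confines the conjugate oracle without a formula for the conjugate. When
  the summand depends on one block only, its conjugate is infinite at every vector with a
  nonzero entry in another block.
\<close>

lemma oracle_answer_reflection_fixed:
  assumes R: "reflection R" and inv: "\<And>y. g j (R y) = g j y"
    and fixed: "R x = x" and d: "d \<in> oracle_answer g (q, j, x)"
  shows "R d = d"
proof (cases q)
  case Primal
  then show ?thesis
    using GDERIV_reflection_fixed[of R "g j"] R inv fixed d by auto
next
  case Dual
  then have "GDERIV (\<lambda>z. real_of_ereal (convex_conjugate (g j) z)) x :> d"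
    using d by (simp add: has_conjugate_gradient_def)
  then show ?thesis
    by (rule GDERIV_reflection_fixed[OF R _ fixed, rotated])
       (simp add: convex_conjugate_reflection[of R "g j", OF R inv])
qed

section \<open>Functions between two quadratics\<close>

text \<open>
  For a gradient map \<open>g\<close> of \<open>f\<close>, this collects strong convexity and smoothness in a form that is
  inherited by weighted sums over blocks; \<open>\<mu> = 0\<close> is plain convexity.
\<close>

definition quadratically_bounded ::
  "real \<Rightarrow> real \<Rightarrow> ('e::real_inner \<Rightarrow> real) \<Rightarrow> ('e \<Rightarrow> 'e) \<Rightarrow> bool"
  where "quadratically_bounded \<mu> L f g \<longleftrightarrow> (\<forall>u v.
    f u + inner (g u) (v - u) + \<mu> / 2 * (norm (v - u))\<^sup>2 \<le> f v \<and>
    f v \<le> f u + inner (g u) (v - u) + L / 2 * (norm (v - u))\<^sup>2 \<and>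
    norm (g u - g v) \<le> L * norm (u - v))"

lemma quadratically_boundedD:
  assumes "quadratically_bounded \<mu> L f g"
  shows "f u + inner (g u) (v - u) + \<mu> / 2 * (norm (v - u))\<^sup>2 \<le> f v"
    and "f v \<le> f u + inner (g u) (v - u) + L / 2 * (norm (v - u))\<^sup>2"
    and "norm (g u - g v) \<le> L * norm (u - v)"
  using assms by (auto simp: quadratically_bounded_def)

lemma GDERIV_if_quadratic_remainder:
  assumes "\<And>h. \<bar>f (x + h) - f x - inner h d\<bar> \<le> C * (norm h)\<^sup>2"
  shows "GDERIV f x :> d"
  unfolding gderiv_def
proof (rule has_derivativeI_sandwich[where e = 1 and H = "\<lambda>y. C * norm (y - x)"])
  show "bounded_linear (\<lambda>h. inner h d)" by (rule bounded_linear_inner_left)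
  show "norm (f y - f x - inner (y - x) d) / norm (y - x) \<le> C * norm (y - x)"
    if "y \<noteq> x" for y
    using assms[of "y - x"] that by (simp add: divide_le_eq power2_eq_square mult.assoc)
  show "((\<lambda>y. C * norm (y - x)) \<longlongrightarrow> 0) (at x)"
    by (auto intro!: tendsto_eq_intros)
qed simp

lemma quadratically_bounded_GDERIV:
  fixes f :: "'e::real_inner \<Rightarrow> real"
  assumes "quadratically_bounded \<mu> L f g" "0 \<le> \<mu>" "\<mu> \<le> L"
  shows "GDERIV f x :> g x"
proof (rule GDERIV_if_quadratic_remainder)
  fix h :: 'e
  have "0 \<le> \<mu> / 2 * (norm h)\<^sup>2" "0 \<le> L / 2 * (norm h)\<^sup>2"
    using assms by simp_all
  moreover have "inner (g x) (x + h - x) = inner h (g x)" by (simp add: inner_commute)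
  moreover have "x + h - x = h" by simp
  ultimately show "\<bar>f (x + h) - f x - inner h (g x)\<bar> \<le> L / 2 * (norm h)\<^sup>2"
    using quadratically_boundedD(1,2)[OF assms(1), where u = x and v = "x + h"] by (simp only:)
qed

lemma quadratically_bounded_smooth:
  assumes "quadratically_bounded \<mu> L f g" "0 \<le> \<mu>" "\<mu> \<le> L"
  shows "smooth_with L f"
  unfolding smooth_with_def
  using quadratically_bounded_GDERIV[OF assms] quadratically_boundedD(3)[OF assms(1)] by blast

lemma quadratically_bounded_strongly_convex:
  assumes "quadratically_bounded \<mu> L f g" "0 \<le> \<mu>" "\<mu> \<le> L"
  shows "strongly_convex \<mu> f"
  unfolding strongly_convex_def
  using quadratically_bounded_GDERIV[OF assms] quadratically_boundedD(1)[OF assms(1)] by blast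

lemma quadratically_bounded_convex:
  fixes f :: "'e::real_inner \<Rightarrow> real"
  assumes "quadratically_bounded \<mu> L f g" "0 \<le> \<mu>"
  shows "convex_on UNIV f"
proof (rule convex_onI)
  fix t :: real and x y :: 'e
  assume t: "0 < t" "t < 1"
  define z where "z = (1 - t) *\<^sub>R x + t *\<^sub>R y"
  have lower: "f z + inner (g z) (v - z) \<le> f v" for v :: 'e
  proof -
    have "0 \<le> \<mu> / 2 * (norm (v - z))\<^sup>2" using assms by simp
    then show ?thesis using quadratically_boundedD(1)[OF assms(1), of z v] by linarith
  qed
  have "(1 - t) *\<^sub>R (x - z) + t *\<^sub>R (y - z) = 0"
    by (simp add: z_def algebra_simps)
  then have "(1 - t) * inner (g z) (x - z) + t * inner (g z) (y - z) = 0"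
    by (metis inner_add_right inner_scaleR_right inner_zero_right)
  moreover have "(1 - t) * (f z + inner (g z) (x - z)) \<le> (1 - t) * f x"
    "t * (f z + inner (g z) (y - z)) \<le> t * f y"
    using t lower by (simp_all add: mult_left_mono)
  ultimately show "f ((1 - t) *\<^sub>R x + t *\<^sub>R y) \<le> (1 - t) * f x + t * f y"
    unfolding z_def[symmetric] by (simp add: algebra_simps)
qed simp

lemma norm_vec_power2: "(norm x)\<^sup>2 = (\<Sum>j\<in>UNIV. (norm (x $ j))\<^sup>2)"
  by (simp add: norm_vec_def L2_set_def sum_nonneg)

text \<open>
  Weights \<open>a\<close> between \<open>lo\<close> and \<open>hi\<close> cover both a single summand, where one block has weight
  \<open>n\<close> and the others have weight zero, and the average of the summands, where all weights are 1.
\<close>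

lemma quadratically_bounded_blocks:
  fixes a :: "'n::finite \<Rightarrow> real" and \<phi> :: "'e::real_inner \<Rightarrow> real"
  assumes \<phi>: "quadratically_bounded \<mu> L \<phi> g" and \<mu>: "0 \<le> \<mu>" and L: "0 \<le> L" and lo: "0 \<le> lo"
    and a: "\<And>j. lo \<le> a j" "\<And>j. a j \<le> hi"
  shows "quadratically_bounded (lo * \<mu>) (hi * L)
    (\<lambda>x. \<Sum>j\<in>UNIV. a j * \<phi> (x $ j)) (\<lambda>x. \<chi> j. a j *\<^sub>R g (x $ j))"
  unfolding quadratically_bounded_def
proof (intro allI conjI)
  fix u v :: "'e ^ 'n"
  have a0: "0 \<le> a j" for j using lo a(1)[of j] by linarith
  have hi0: "0 \<le> hi" using a0 a(2) by (meson order_trans)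
  let ?lin = "\<lambda>j. a j * \<phi> (u $ j) + a j * inner (g (u $ j)) (v $ j - u $ j)"
  have split: "(\<Sum>j\<in>UNIV. ?lin j + c / 2 * (norm (v $ j - u $ j))\<^sup>2) =
      (\<Sum>j\<in>UNIV. a j * \<phi> (u $ j)) + inner (\<chi> j. a j *\<^sub>R g (u $ j)) (v - u)
        + c / 2 * (norm (v - u))\<^sup>2" for c
    by (simp add: sum.distrib inner_vec_def norm_vec_power2 sum_distrib_left)
  have "?lin j + lo * \<mu> / 2 * (norm (v $ j - u $ j))\<^sup>2 \<le> a j * \<phi> (v $ j)" for j
  proof -
    have "lo * (\<mu> / 2 * (norm (v $ j - u $ j))\<^sup>2) \<le> a j * (\<mu> / 2 * (norm (v $ j - u $ j))\<^sup>2)"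
      using a(1) \<mu> by (intro mult_right_mono) auto
    moreover have "a j * (\<phi> (u $ j) + inner (g (u $ j)) (v $ j - u $ j)
        + \<mu> / 2 * (norm (v $ j - u $ j))\<^sup>2) \<le> a j * \<phi> (v $ j)"
      by (rule mult_left_mono[OF quadratically_boundedD(1)[OF \<phi>] a0])
    ultimately show ?thesis by (simp add: algebra_simps)
  qed
  then show "(\<Sum>j\<in>UNIV. a j * \<phi> (u $ j)) + inner (\<chi> j. a j *\<^sub>R g (u $ j)) (v - u)
      + lo * \<mu> / 2 * (norm (v - u))\<^sup>2 \<le> (\<Sum>j\<in>UNIV. a j * \<phi> (v $ j))"
    unfolding split[symmetric] by (rule sum_mono)
  have "a j * \<phi> (v $ j) \<le> ?lin j + hi * L / 2 * (norm (v $ j - u $ j))\<^sup>2" for j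
  proof -
    have "a j * (L / 2 * (norm (v $ j - u $ j))\<^sup>2) \<le> hi * (L / 2 * (norm (v $ j - u $ j))\<^sup>2)"
      using a(2) L by (intro mult_right_mono) auto
    moreover have "a j * \<phi> (v $ j) \<le> a j * (\<phi> (u $ j) + inner (g (u $ j)) (v $ j - u $ j)
        + L / 2 * (norm (v $ j - u $ j))\<^sup>2)"
      by (rule mult_left_mono[OF quadratically_boundedD(2)[OF \<phi>] a0])
    ultimately show ?thesis by (simp add: algebra_simps)
  qed
  then show "(\<Sum>j\<in>UNIV. a j * \<phi> (v $ j)) \<le>
      (\<Sum>j\<in>UNIV. a j * \<phi> (u $ j)) + inner (\<chi> j. a j *\<^sub>R g (u $ j)) (v - u)
      + hi * L / 2 * (norm (v - u))\<^sup>2"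
    unfolding split[symmetric] by (rule sum_mono)
  have "norm (a j *\<^sub>R (g (u $ j) - g (v $ j))) \<le> hi * L * norm (u $ j - v $ j)" for j
  proof -
    have "a j * norm (g (u $ j) - g (v $ j)) \<le> hi * (L * norm (u $ j - v $ j))"
      by (rule mult_mono[OF a(2) quadratically_boundedD(3)[OF \<phi>] hi0]) simp
    then show ?thesis using a0[of j] by (simp add: mult.assoc)
  qed
  then have "(norm (a j *\<^sub>R (g (u $ j) - g (v $ j))))\<^sup>2 \<le> (hi * L)\<^sup>2 * (norm (u $ j - v $ j))\<^sup>2"
    for j unfolding power_mult_distrib[symmetric] by (intro power_mono) auto
  then have "(norm ((\<chi> j. a j *\<^sub>R g (u $ j)) - (\<chi> j. a j *\<^sub>R g (v $ j))))\<^sup>2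
      \<le> (hi * L * norm (u - v))\<^sup>2"
    by (simp add: norm_vec_power2 power_mult_distrib sum_distrib_left sum_mono
        scaleR_diff_right[symmetric])
  then show "norm ((\<chi> j. a j *\<^sub>R g (u $ j)) - (\<chi> j. a j *\<^sub>R g (v $ j)))
      \<le> hi * L * norm (u - v)"
    by (rule power2_le_imp_le) (use hi0 L in auto)
qed

section \<open>Sequence space\<close>

lemma ell2_eqI: "(\<And>l. ell2_nth x l = ell2_nth y l) \<Longrightarrow> x = y"
  by (simp add: ell2_nth_inject[symmetric] fun_eq_iff)

lemma norm_ell2_power2: "(norm x)\<^sup>2 = (\<Sum>l. (ell2_nth x l)\<^sup>2)"
  by (simp add: power2_norm_eq_inner inner_ell2_def flip: power2_eq_square)

lift_definition unit0 :: ell2 is "\<lambda>l. if l = 0 then 1 else 0"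
  by (rule summable_finite[of "{0}"]) auto

lemma inner_unit0: "inner unit0 y = ell2_nth y 0"
proof -
  have "inner unit0 y = (\<Sum>l\<in>{0}. ell2_nth unit0 l * ell2_nth y l)"
    unfolding inner_ell2_def by (rule suminf_finite) (auto simp: unit0.rep_eq)
  then show ?thesis by (simp add: unit0.rep_eq)
qed

lift_definition geometric :: "real \<Rightarrow> ell2"
  is "\<lambda>q l. if \<bar>q\<bar> < 1 then q ^ l else 0"
proof -
  fix q :: real
  have "summable (\<lambda>l. (q\<^sup>2) ^ l)" if "\<bar>q\<bar> < 1"
    using that by (intro summable_geometric) (simp add: abs_square_less_1)
  then show "summable (\<lambda>l. (if \<bar>q\<bar> < 1 then q ^ l else 0)\<^sup>2)"
    by (cases "\<bar>q\<bar> < 1") (simp_all add: power_mult[symmetric] mult.commute)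
qed

lift_definition flip_from :: "nat \<Rightarrow> ell2 \<Rightarrow> ell2"
  is "\<lambda>k x l. if l < k then x l else - x l"
proof -
  fix k and x :: "nat \<Rightarrow> real"
  have "(\<lambda>l. (if l < k then x l else - x l)\<^sup>2) = (\<lambda>l. (x l)\<^sup>2)" by auto
  then show "summable (\<lambda>l. (x l)\<^sup>2) \<Longrightarrow> summable (\<lambda>l. (if l < k then x l else - x l)\<^sup>2)"
    by simp
qed

lemma reflection_flip_from: "reflection (flip_from k)"
proof -
  have "linear (flip_from k)"
    by (rule linearI) (auto intro!: ell2_eqI simp: flip_from.rep_eq ell2_nth_simps)
  moreover have "flip_from k (flip_from k x) = x" for x
    by (rule ell2_eqI) (simp add: flip_from.rep_eq)
  moreover have "inner (flip_from k x) y = inner x (flip_from k y)" for x y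
    unfolding inner_ell2_def by (rule arg_cong[where f = suminf]) (auto simp: flip_from.rep_eq)
  ultimately show ?thesis by (simp add: reflection_def)
qed

lift_definition permute :: "(nat \<Rightarrow> nat) \<Rightarrow> ell2 \<Rightarrow> ell2"
  is "\<lambda>\<sigma> x. if bij \<sigma> then x \<circ> \<sigma> else x"
proof -
  fix \<sigma> :: "nat \<Rightarrow> nat" and x :: "nat \<Rightarrow> real"
  assume "summable (\<lambda>l. (x l)\<^sup>2)"
  then have "summable ((\<lambda>l. (x l)\<^sup>2) \<circ> \<sigma>)" if "bij \<sigma>"
    using that by (intro summable_reindex) (auto simp: bij_def)
  then show "summable (\<lambda>l. ((if bij \<sigma> then x \<circ> \<sigma> else x) l)\<^sup>2)"
    using \<open>summable (\<lambda>l. (x l)\<^sup>2)\<close> by (simp add: comp_def)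
qed

lemma norm_permute:
  assumes "bij \<sigma>"
  shows "norm (permute \<sigma> x) = norm x"
proof -
  have "(\<Sum>l. ((\<lambda>l. (ell2_nth x l)\<^sup>2) \<circ> \<sigma>) l) = (\<Sum>l. (ell2_nth x l)\<^sup>2)"
    using assms summable_ell2_power2 by (intro suminf_reindex) (auto simp: bij_def)
  then have "(norm (permute \<sigma> x))\<^sup>2 = (norm x)\<^sup>2"
    using assms by (simp add: norm_ell2_power2 permute.rep_eq comp_def)
  then show ?thesis by (simp add: power2_eq_iff_nonneg)
qed

lemma permute_add: "permute \<sigma> (x + y) = permute \<sigma> x + permute \<sigma> y"
  and permute_diff: "permute \<sigma> (x - y) = permute \<sigma> x - permute \<sigma> y"
  by (rule ell2_eqI, simp add: permute.rep_eq ell2_nth_simps)+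

lemma inner_permute:
  assumes \<sigma>: "bij \<sigma>" and inv: "\<And>l. \<sigma> (\<sigma> l) = l"
  shows "inner (permute \<sigma> x) y = inner x (permute \<sigma> y)"
proof -
  have "permute \<sigma> (permute \<sigma> y) = y"
    by (rule ell2_eqI) (simp add: permute.rep_eq \<sigma> inv)
  then have "inner (permute \<sigma> x) y = inner (permute \<sigma> x) (permute \<sigma> (permute \<sigma> y))" by simp
  also have "\<dots> = inner x (permute \<sigma> y)"
    by (simp add: dot_norm norm_permute[OF \<sigma>] permute_add[symmetric])
  finally show ?thesis .
qed

text \<open>
  The tail of the geometric sequence from \<open>k\<close> on is a shifted copy of the sequence scaled by
  \<open>q ^ k\<close>, and a vector supported before \<open>k\<close> misses all of it.
\<close>

lemma relative_error_geometric:
  assumes q: "0 \<le> q" "q < 1" and y: "\<And>l. k \<le> l \<Longrightarrow> ell2_nth y l = 0"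
  shows "q ^ (2 * k) \<le> (norm (y - geometric q))\<^sup>2 / (norm (0 - geometric q))\<^sup>2"
proof -
  let ?x = "geometric q"
  have nth: "ell2_nth ?x l = q ^ l" for l using q by (simp add: geometric.rep_eq)
  then have "?x \<noteq> 0" by (metis power_0 zero_ell2.rep_eq zero_neq_one)
  have "q ^ (2 * k) * (norm ?x)\<^sup>2 = (\<Sum>l. (ell2_nth (y - ?x) (l + k))\<^sup>2)"
    unfolding norm_ell2_power2
    by (subst suminf_mult[OF summable_ell2_power2, symmetric])
      (simp add: ell2_nth_simps y nth power_add power_mult power_mult_distrib mult.commute
        power_commutes flip: power_mult)
  also have "\<dots> \<le> (\<Sum>l. (ell2_nth (y - ?x) l)\<^sup>2)"
    using suminf_split_initial_segment[OF summable_ell2_power2, of "y - ?x" k]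
    by (simp add: sum_nonneg)
  finally show ?thesis
    using \<open>?x \<noteq> 0\<close> by (simp add: le_divide_eq norm_ell2_power2[of "y - ?x"])
qed

section \<open>The local quadratics\<close>

text \<open>
  For an involution \<open>\<sigma>\<close>, the term \<open>(norm y)\<^sup>2 - inner (permute \<sigma> y) y\<close> is the sum of
  \<open>(y l - y (\<sigma> l))\<^sup>2\<close> over the pairs that \<open>\<sigma>\<close> swaps: it couples no other coordinates.
\<close>

definition pair_energy :: "real \<Rightarrow> real \<Rightarrow> (nat \<Rightarrow> nat) \<Rightarrow> real \<Rightarrow> ell2 \<Rightarrow> real"
  where "pair_energy \<mu> \<gamma> \<sigma> b y =
    \<mu> / 2 * (norm y)\<^sup>2 + \<gamma> / 4 * ((norm y)\<^sup>2 - inner (permute \<sigma> y) y) - b * ell2_nth y 0"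

definition pair_gradient :: "real \<Rightarrow> real \<Rightarrow> (nat \<Rightarrow> nat) \<Rightarrow> real \<Rightarrow> ell2 \<Rightarrow> ell2"
  where "pair_gradient \<mu> \<gamma> \<sigma> b y =
    \<mu> *\<^sub>R y + (\<gamma> / 2) *\<^sub>R (y - permute \<sigma> y) - b *\<^sub>R unit0"

lemma quadratically_bounded_pair_energy:
  assumes \<sigma>: "bij \<sigma>" "\<And>l. \<sigma> (\<sigma> l) = l" and "0 \<le> \<mu>" "0 \<le> \<gamma>"
  shows "quadratically_bounded \<mu> (\<mu> + \<gamma>) (pair_energy \<mu> \<gamma> \<sigma> b) (pair_gradient \<mu> \<gamma> \<sigma> b)"
  unfolding quadratically_bounded_def
proof (intro allI conjI)
  fix u v :: ell2
  define h where "h = v - u"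
  have v: "v = u + h" by (simp add: h_def)
  have swap: "\<bar>inner (permute \<sigma> h) h\<bar> \<le> (norm h)\<^sup>2"
    using Cauchy_Schwarz_ineq2[of "permute \<sigma> h" h]
    by (simp add: norm_permute[OF \<sigma>(1)] power2_eq_square)
  have sym: "inner (permute \<sigma> h) u = inner (permute \<sigma> u) h"
    using inner_permute[OF \<sigma>, of h u] by (simp add: inner_commute)
  have expansion: "pair_energy \<mu> \<gamma> \<sigma> b v = pair_energy \<mu> \<gamma> \<sigma> b u
      + inner (pair_gradient \<mu> \<gamma> \<sigma> b u) (v - u) + \<mu> / 2 * (norm (v - u))\<^sup>2
      + \<gamma> / 4 * ((norm (v - u))\<^sup>2 - inner (permute \<sigma> (v - u)) (v - u))"
    unfolding h_def[symmetric] v pair_energy_def pair_gradient_def power2_norm_eq_inner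
    by (simp add: permute_add inner_add_left inner_add_right inner_diff_left inner_unit0 sym
        ell2_nth_simps inner_commute[of h u] algebra_simps add_divide_distrib)
  have "0 \<le> \<gamma> / 4 * ((norm h)\<^sup>2 - inner (permute \<sigma> h) h)"
    using swap \<open>0 \<le> \<gamma>\<close> by (intro mult_nonneg_nonneg) auto
  then show "pair_energy \<mu> \<gamma> \<sigma> b u + inner (pair_gradient \<mu> \<gamma> \<sigma> b u) (v - u)
      + \<mu> / 2 * (norm (v - u))\<^sup>2 \<le> pair_energy \<mu> \<gamma> \<sigma> b v"
    by (simp add: expansion h_def)
  have "\<gamma> / 4 * ((norm h)\<^sup>2 - inner (permute \<sigma> h) h) \<le> \<gamma> / 4 * (2 * (norm h)\<^sup>2)"
    using swap \<open>0 \<le> \<gamma>\<close> by (intro mult_left_mono) auto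
  then show "pair_energy \<mu> \<gamma> \<sigma> b v \<le> pair_energy \<mu> \<gamma> \<sigma> b u
      + inner (pair_gradient \<mu> \<gamma> \<sigma> b u) (v - u) + (\<mu> + \<gamma>) / 2 * (norm (v - u))\<^sup>2"
    by (simp add: expansion h_def algebra_simps add_divide_distrib)
  have "pair_gradient \<mu> \<gamma> \<sigma> b u - pair_gradient \<mu> \<gamma> \<sigma> b v
      = \<mu> *\<^sub>R (u - v) + (\<gamma> / 2) *\<^sub>R ((u - v) - permute \<sigma> (u - v))"
    by (simp add: pair_gradient_def permute_diff algebra_simps)
  also have "norm \<dots> \<le> norm (\<mu> *\<^sub>R (u - v)) + norm ((\<gamma> / 2) *\<^sub>R ((u - v) - permute \<sigma> (u - v)))"
    by (rule norm_triangle_ineq)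
  also have "norm (\<mu> *\<^sub>R (u - v)) = \<mu> * norm (u - v)"
    using \<open>0 \<le> \<mu>\<close> by simp
  also have "norm ((\<gamma> / 2) *\<^sub>R ((u - v) - permute \<sigma> (u - v)))
      = \<gamma> / 2 * norm ((u - v) - permute \<sigma> (u - v))"
    using \<open>0 \<le> \<gamma>\<close> by simp
  also have "\<dots> \<le> \<gamma> / 2 * (norm (u - v) + norm (u - v))"
    using norm_triangle_ineq4[of "u - v" "permute \<sigma> (u - v)"] \<open>0 \<le> \<gamma>\<close>
    by (intro mult_left_mono) (simp_all add: norm_permute[OF \<sigma>(1)])
  finally show "norm (pair_gradient \<mu> \<gamma> \<sigma> b u - pair_gradient \<mu> \<gamma> \<sigma> b v)
      \<le> (\<mu> + \<gamma>) * norm (u - v)"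
    by (simp add: algebra_simps)
qed

lemma pair_energy_flip_from:
  assumes \<sigma>: "bij \<sigma>" "\<And>l. \<sigma> l < k \<longleftrightarrow> l < k" and b: "b = 0 \<or> 0 < k"
  shows "pair_energy \<mu> \<gamma> \<sigma> b (flip_from k y) = pair_energy \<mu> \<gamma> \<sigma> b y"
proof -
  have "permute \<sigma> (flip_from k y) = flip_from k (permute \<sigma> y)"
    by (rule ell2_eqI) (simp add: permute.rep_eq flip_from.rep_eq \<sigma>)
  moreover have "inner (flip_from k (permute \<sigma> y)) (flip_from k y) = inner (permute \<sigma> y) y"
    using reflection_flip_from by (simp add: reflection_def)
  ultimately show ?thesis
    using b by (auto simp: pair_energy_def norm_reflection[OF reflection_flip_from] flip_from.rep_eq)
qed

section \<open>The rotating star\<close>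

definition star :: "nat \<Rightarrow> nat \<Rightarrow> nat pair_pre_digraph"
  where "star m c = \<lparr>pverts = {1..m},
    parcs = {(i, j). i \<in> {1..m} \<and> j \<in> {1..m} \<and> i \<noteq> j \<and> (i = c \<or> j = c)}\<rparr>"

definition star_gossip :: "nat \<Rightarrow> nat \<Rightarrow> nat \<Rightarrow> nat \<Rightarrow> real"
  where "star_gossip m c i j =
    (if i = j then (if i = c then 1 - 1 / real m else 1 / real m)
     else if i = c \<or> j = c then - (1 / real m) else 0)"

text \<open>Nodes 1 and 2 never become the hub; the others take turns with period \<open>p\<close>.\<close>

definition hub :: "nat \<Rightarrow> nat \<Rightarrow> nat"
  where "hub p r = 3 + (r - 1) mod p"

lemma pair_graph_star: "pair_graph (star m c)"
proof
  show "finite (parcs (star m c))"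
    by (rule finite_subset[of _ "{1..m} \<times> {1..m}"]) (auto simp: star_def)
  show "symmetric (with_proj (star m c))"
    by (auto simp: symmetric_def sym_def star_def arcs_ends_def arc_to_ends_def)
qed (auto simp: star_def)

lemma sum_star_gossip:
  fixes x :: "nat \<Rightarrow> 'a::real_vector"
  assumes "c \<in> {1..m}" "i \<in> {1..m}"
  shows "(\<Sum>j\<in>{1..m}. star_gossip m c i j *\<^sub>R x j) =
    (if i = c then x c - (1 / real m) *\<^sub>R (\<Sum>j\<in>{1..m}. x j) else (1 / real m) *\<^sub>R (x i - x c))"
proof (cases "i = c")
  case True
  have "star_gossip m c i j *\<^sub>R x j = (if j = c then x c else 0) - (1 / real m) *\<^sub>R x j" for j
    using True by (auto simp: star_gossip_def algebra_simps)
  then show ?thesis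
    using True assms by (simp add: sum_subtractf sum.delta scaleR_sum_right)
next
  case False
  have "star_gossip m c i j *\<^sub>R x j =
      (1 / real m) *\<^sub>R ((if j = i then x i else 0) - (if j = c then x c else 0))" for j
    using False by (auto simp: star_gossip_def)
  then show ?thesis
    using False assms by (simp add: sum_subtractf sum.delta flip: scaleR_sum_right)
qed

text \<open>
  The matrix is the Laplacian of the star divided by \<open>m\<close>. On vectors of sum zero, \<open>W - I\<close>
  annihilates the hub entry and sends a leaf entry to minus a convex combination of itself and
  the hub entry, so convexity of the squared norm yields the contraction factor \<open>1 - 1 / m\<close>.
\<close>

lemma star_gossip_contraction:
  fixes x :: "nat \<Rightarrow> 'e::real_inner"
  assumes c: "c \<in> {1..m}" and sum0: "(\<Sum>i\<in>{1..m}. x i) = 0"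
  shows "(\<Sum>i\<in>{1..m}. (norm ((\<Sum>j\<in>{1..m}. star_gossip m c i j *\<^sub>R x j) - x i))\<^sup>2)
    \<le> (1 - 1 / real m) * (\<Sum>i\<in>{1..m}. (norm (x i))\<^sup>2)"
proof -
  let ?t = "1 / real m"
  have t: "0 \<le> ?t" "?t \<le> 1" using c by auto
  have leaf: "(norm ((\<Sum>j\<in>{1..m}. star_gossip m c i j *\<^sub>R x j) - x i))\<^sup>2
      \<le> (1 - ?t) * (norm (x i))\<^sup>2 + ?t * (norm (x c))\<^sup>2" if "i \<in> {1..m} - {c}" for i
  proof -
    have "(\<Sum>j\<in>{1..m}. star_gossip m c i j *\<^sub>R x j) - x i =
        - ((1 - ?t) *\<^sub>R x i + ?t *\<^sub>R x c)"
      using that c by (subst sum_star_gossip) (auto simp: algebra_simps)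
    then have "norm ((\<Sum>j\<in>{1..m}. star_gossip m c i j *\<^sub>R x j) - x i)
        \<le> (1 - ?t) * norm (x i) + ?t * norm (x c)"
      using norm_triangle_ineq[of "(1 - ?t) *\<^sub>R x i" "?t *\<^sub>R x c"] t
      by (simp only: norm_minus_cancel norm_scaleR abs_of_nonneg diff_ge_0_iff_ge)
    then have "(norm ((\<Sum>j\<in>{1..m}. star_gossip m c i j *\<^sub>R x j) - x i))\<^sup>2
        \<le> ((1 - ?t) * norm (x i) + ?t * norm (x c))\<^sup>2"
      by (rule power_mono) simp
    also have "\<dots> \<le> (1 - ?t) * (norm (x i))\<^sup>2 + ?t * (norm (x c))\<^sup>2"
    proof -
      have "0 \<le> ?t * (1 - ?t) * (norm (x i) - norm (x c))\<^sup>2"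
        using t by (intro mult_nonneg_nonneg) auto
      then show ?thesis by (simp only: power2_eq_square) (simp add: algebra_simps)
    qed
    finally show ?thesis .
  qed
  have "(\<Sum>j\<in>{1..m}. star_gossip m c c j *\<^sub>R x j) - x c = 0"
    using sum_star_gossip[OF c c, of x] sum0 by simp
  then have "(\<Sum>i\<in>{1..m}. (norm ((\<Sum>j\<in>{1..m}. star_gossip m c i j *\<^sub>R x j) - x i))\<^sup>2)
      = (\<Sum>i\<in>{1..m} - {c}. (norm ((\<Sum>j\<in>{1..m}. star_gossip m c i j *\<^sub>R x j) - x i))\<^sup>2)"
    by (intro sum.mono_neutral_right) auto
  also have "\<dots> \<le> (\<Sum>i\<in>{1..m} - {c}. (1 - ?t) * (norm (x i))\<^sup>2 + ?t * (norm (x c))\<^sup>2)"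
    by (rule sum_mono) (rule leaf)
  also have "\<dots> = (1 - ?t) * (\<Sum>i\<in>{1..m} - {c}. (norm (x i))\<^sup>2) + (1 - ?t) * (norm (x c))\<^sup>2"
  proof -
    have "(\<Sum>i\<in>{1..m} - {c}. ?t * (norm (x c))\<^sup>2) = (1 - ?t) * (norm (x c))\<^sup>2"
      using c by (simp add: of_nat_diff divide_simps)
    then show ?thesis by (simp only: sum.distrib sum_distrib_left)
  qed
  also have "\<dots> = (1 - ?t) * (\<Sum>i\<in>{1..m}. (norm (x i))\<^sup>2)"
    using c by (simp add: sum.remove[of _ c] distrib_left)
  finally show ?thesis .
qed

lemma gossip_assumption_star:
  assumes m: "2 \<le> m" and chi: "real m \<le> chi" and c: "\<And>k. 1 \<le> k \<Longrightarrow> c k \<in> {1..m}"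
  shows "gossip_assumption TYPE('e::real_inner) chi m (\<lambda>k. star m (c k)) (\<lambda>k. star_gossip m (c k))"
  unfolding gossip_assumption_def
proof (intro allI impI conjI ballI)
  fix k :: nat
  assume "1 \<le> k"
  then have ck: "c k \<in> {1..m}" by (rule c)
  have row_sum: "(\<Sum>j\<in>{1..m}. star_gossip m (c k) i j * a) = 0" if "i \<in> {1..m}" for i a
    using sum_star_gossip[OF ck that, of "\<lambda>_. a"] m by simp
  show "(star_gossip m (c k) i j \<noteq> 0) = ((i, j) \<in> parcs (star m (c k)) \<or> i = j)"
    if "i \<in> {1..m}" "j \<in> {1..m}" for i j
    using that m by (auto simp: star_gossip_def star_def)
  show "(\<Sum>j\<in>{1..m}. star_gossip m (c k) i j * a) = 0" if "i \<in> {1..m}" for i a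
    using that by (rule row_sum)
  show "(\<Sum>i\<in>{1..m}. \<Sum>j\<in>{1..m}. star_gossip m (c k) i j * a j) = 0" for a
  proof -
    have sym: "star_gossip m (c k) i j = star_gossip m (c k) j i" for i j
      by (auto simp: star_gossip_def)
    have "(\<Sum>i\<in>{1..m}. \<Sum>j\<in>{1..m}. star_gossip m (c k) i j * a j)
        = (\<Sum>j\<in>{1..m}. \<Sum>i\<in>{1..m}. star_gossip m (c k) j i * a j)"
      by (subst sum.swap) (simp add: sym)
    also have "\<dots> = 0"
      by (intro sum.neutral ballI row_sum)
    finally show ?thesis .
  qed
  show "(\<Sum>i\<in>{1..m}. (norm ((\<Sum>j\<in>{1..m}. star_gossip m (c k) i j *\<^sub>R x j) - x i))\<^sup>2)
      \<le> (1 - 1 / chi) * (\<Sum>i\<in>{1..m}. (norm (x i))\<^sup>2)"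
    if "(\<Sum>i\<in>{1..m}. x i) = 0" for x :: "nat \<Rightarrow> 'e"
  proof -
    have "1 - 1 / real m \<le> 1 - 1 / chi" using m chi by (simp add: frac_le)
    then have "(1 - 1 / real m) * (\<Sum>i\<in>{1..m}. (norm (x i))\<^sup>2)
        \<le> (1 - 1 / chi) * (\<Sum>i\<in>{1..m}. (norm (x i))\<^sup>2)"
      by (rule mult_right_mono) (simp add: sum_nonneg)
    then show ?thesis
      using star_gossip_contraction[OF ck that] by (rule order_trans[rotated])
  qed
qed

text \<open>
  Communications are grouped into phases of \<open>p\<close> rounds, in which the \<open>p\<close> nodes other than 1 and 2
  are hub once each. At the start of phase \<open>s\<close> only node 1 (\<open>s\<close> even) or node 2 (\<open>s\<close> odd) can know
  coordinate \<open>s\<close>. A leaf learns only what the hub knew before, so after \<open>u\<close> rounds of the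
  phase this coordinate has reached at most the \<open>u\<close> hubs used so far; node 2 or 1, which could
  produce the next coordinate, receives it at the end of the phase at the earliest.
\<close>

definition level :: "nat \<Rightarrow> nat \<Rightarrow> nat \<Rightarrow> nat"
  where "level p i r = r div p +
    (if (if i = 1 then even (r div p) else if i = 2 then odd (r div p) else i - 3 < r mod p)
     then 1 else 0)"

lemma level_step:
  assumes "0 < p" "i \<in> {1..p + 2}" "j = i \<or> (i, j) \<in> parcs (star (p + 2) (hub p (Suc r)))"
  shows "level p j r \<le> level p i (Suc r)"
proof (cases "Suc (r mod p) = p")
  case True
  then show ?thesis using assms(1) by (simp add: level_def div_Suc mod_Suc)
next
  case False
  have "j = i \<or> i = 3 + r mod p \<or> j = 3 + r mod p"
    using assms(3) by (auto simp: star_def hub_def)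
  then show ?thesis using False assms(1) by (auto simp: level_def div_Suc mod_Suc)
qed

section \<open>The hard instance\<close>

definition odd_pairs :: "nat \<Rightarrow> nat"
  where "odd_pairs l = (if l = 0 then 0 else if odd l then Suc l else l - 1)"

definition even_pairs :: "nat \<Rightarrow> nat"
  where "even_pairs l = (if even l then Suc l else l - 1)"

definition node_pairs :: "nat \<Rightarrow> nat \<Rightarrow> nat"
  where "node_pairs i = (if i = 1 then odd_pairs else if i = 2 then even_pairs else id)"

definition node_convexity :: "nat \<Rightarrow> nat \<Rightarrow> real"
  where "node_convexity p i = (if i = 1 \<or> i = 2 then 1 else 1 / real p)"

definition node_coupling :: "real \<Rightarrow> nat \<Rightarrow> real"
  where "node_coupling \<kappa> i = (if i = 1 \<or> i = 2 then \<kappa> - 1 else 0)"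

text \<open>This coefficient makes the geometric sequence stationary at coordinate 0.\<close>

definition node_linear :: "real \<Rightarrow> nat \<Rightarrow> real"
  where "node_linear \<kappa> i = (if i = 1 then 3 + (\<kappa> - 1) / 2 * (1 - rate1 \<kappa>) else 0)"

definition node_energy :: "nat \<Rightarrow> real \<Rightarrow> nat \<Rightarrow> ell2 \<Rightarrow> real"
  where "node_energy p \<kappa> i =
    pair_energy (node_convexity p i) (node_coupling \<kappa> i) (node_pairs i) (node_linear \<kappa> i)"

definition node_gradient :: "nat \<Rightarrow> real \<Rightarrow> nat \<Rightarrow> ell2 \<Rightarrow> ell2"
  where "node_gradient p \<kappa> i =
    pair_gradient (node_convexity p i) (node_coupling \<kappa> i) (node_pairs i) (node_linear \<kappa> i)"

definition summand :: "nat \<Rightarrow> real \<Rightarrow> nat \<Rightarrow> 'n::finite \<Rightarrow> ell2 ^ 'n \<Rightarrow> real"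
  where "summand p \<kappa> i j x = real CARD('n) * node_energy p \<kappa> i (x $ j)"

lemma node_pairs_involution: "node_pairs i (node_pairs i l) = l"
  by (auto simp: node_pairs_def odd_pairs_def even_pairs_def)

lemma bij_node_pairs: "bij (node_pairs i)"
  by (rule o_bij[of "node_pairs i"]) (simp_all add: fun_eq_iff node_pairs_involution)

lemma quadratically_bounded_node_energy:
  assumes "1 \<le> \<kappa>"
  shows "quadratically_bounded (node_convexity p i) (node_convexity p i + node_coupling \<kappa> i)
    (node_energy p \<kappa> i) (node_gradient p \<kappa> i)"
  unfolding node_energy_def node_gradient_def using assms
  by (intro quadratically_bounded_pair_energy bij_node_pairs node_pairs_involution)
    (auto simp: node_convexity_def node_coupling_def)

lemma local_objective_summand:
  "local_objective (summand p \<kappa> i) x = (\<Sum>j\<in>UNIV. node_energy p \<kappa> i (x $ j))"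
  by (simp add: local_objective_def summand_def flip: sum_distrib_left)

text \<open>
  A summand acts on one block with the factor \<open>n\<close>, so its smoothness constant is \<open>n\<close> times that
  of the average, whose condition number is at most \<open>\<kappa>\<close>.
\<close>

lemma summand_regularity:
  fixes j :: "'n::finite" and i :: nat
  assumes \<kappa>: "1 \<le> \<kappa>" and p: "0 < p"
  defines "\<mu> \<equiv> node_convexity p i" and "L \<equiv> node_convexity p i + node_coupling \<kappa> i"
  shows "convex_on UNIV (summand p \<kappa> i j)"
    and "smooth_with (real CARD('n) * L) (summand p \<kappa> i j)"
    and "strongly_convex \<mu> (local_objective (summand p \<kappa> i :: 'n \<Rightarrow> _))"
    and "smooth_with L (local_objective (summand p \<kappa> i :: 'n \<Rightarrow> _))"
    and "0 < \<mu>" and "L \<le> \<kappa> * \<mu>"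
proof -
  show \<mu>: "0 < \<mu>" using p by (simp add: \<mu>_def node_convexity_def)
  show "L \<le> \<kappa> * \<mu>" using \<kappa> p
    by (auto simp: L_def \<mu>_def node_convexity_def node_coupling_def divide_right_mono)
  have \<mu>L: "\<mu> \<le> L" using \<kappa> by (simp add: L_def \<mu>_def node_coupling_def)
  have L: "0 \<le> L" using \<mu> \<mu>L by simp
  note bounded = quadratically_bounded_node_energy[OF \<kappa>, of p i, folded \<mu>_def L_def]
  define a where "a j' = (if j' = j then real CARD('n) else 0)" for j' :: 'n
  have "(\<lambda>x. \<Sum>j'\<in>UNIV. a j' * node_energy p \<kappa> i (x $ j')) = summand p \<kappa> i j"
  proof
    fix x :: "ell2 ^ 'n"
    have "(\<Sum>j'\<in>UNIV. a j' * node_energy p \<kappa> i (x $ j')) =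
        (\<Sum>j'\<in>UNIV. if j' = j then summand p \<kappa> i j x else 0)"
      by (rule sum.cong) (auto simp: a_def summand_def)
    then show "(\<Sum>j'\<in>UNIV. a j' * node_energy p \<kappa> i (x $ j')) = summand p \<kappa> i j x" by simp
  qed
  then have q: "quadratically_bounded (0 * \<mu>) (real CARD('n) * L) (summand p \<kappa> i j)
      (\<lambda>x. \<chi> j'. a j' *\<^sub>R node_gradient p \<kappa> i (x $ j'))"
    using quadratically_bounded_blocks[OF bounded, of 0 a "real CARD('n)"] \<mu> L
    by (simp add: a_def)
  show "convex_on UNIV (summand p \<kappa> i j)"
    by (rule quadratically_bounded_convex[OF q]) simp
  show "smooth_with (real CARD('n) * L) (summand p \<kappa> i j)"
    by (rule quadratically_bounded_smooth[OF q]) (use L in auto)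
  have "quadratically_bounded \<mu> L (local_objective (summand p \<kappa> i :: 'n \<Rightarrow> _))
      (\<lambda>x. \<chi> j'. 1 *\<^sub>R node_gradient p \<kappa> i (x $ j'))"
    using quadratically_bounded_blocks[OF bounded, of 1 "\<lambda>_. 1" 1] \<mu> L
    by (simp add: local_objective_summand[abs_def])
  then show "strongly_convex \<mu> (local_objective (summand p \<kappa> i :: 'n \<Rightarrow> _))"
    "smooth_with L (local_objective (summand p \<kappa> i :: 'n \<Rightarrow> _))"
    using \<mu> \<mu>L by (auto intro: quadratically_bounded_strongly_convex quadratically_bounded_smooth)
qed

lemma rate1_bounds:
  assumes "1 \<le> \<kappa>"
  shows "0 \<le> rate1 \<kappa>" "rate1 \<kappa> < 1"
proof -
  define s where "s = sqrt (2 / 3 * \<kappa> + 1 / 3)"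
  have "1 \<le> s" using assms by (simp add: s_def)
  then show "0 \<le> rate1 \<kappa>" "rate1 \<kappa> < 1"
    unfolding rate1_def s_def[symmetric] by (simp_all add: divide_simps)
qed

text \<open>This is the characteristic equation of the recurrence satisfied by the solution.\<close>

lemma rate1_equation:
  assumes "1 \<le> \<kappa>"
  shows "(\<kappa> - 1) / 2 * (1 - rate1 \<kappa>)\<^sup>2 = 3 * rate1 \<kappa>"
proof -
  define s where "s = sqrt (2 / 3 * \<kappa> + 1 / 3)"
  have s: "0 \<le> s" "s\<^sup>2 = 2 / 3 * \<kappa> + 1 / 3" using assms by (simp_all add: s_def)
  have \<kappa>: "\<kappa> = (3 * s\<^sup>2 - 1) / 2" using s(2) by simp
  show ?thesis
    unfolding rate1_def s_def[symmetric] using s(1)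
    by (simp add: \<kappa> divide_simps) (simp add: power2_eq_square algebra_simps)
qed

lemma sum_nodes:
  fixes g :: "nat \<Rightarrow> 'a::comm_monoid_add"
  shows "(\<Sum>i\<in>{1..p + 2}. g i) = g 1 + g 2 + (\<Sum>i\<in>{3..p + 2}. g i)"
proof -
  have "{1..p + 2} = insert 1 (insert 2 {3..p + 2})" by auto
  then show ?thesis by (simp add: add.assoc)
qed

text \<open>
  The other nodes together contribute the convexity constant 1, so the three contributions turn the
  equation at coordinate \<open>l > 0\<close> into
  \<open>3 x\<^sub>l + (\<kappa> - 1) / 2 (2 x\<^sub>l - x\<^bsub>l-1\<^esub> - x\<^bsub>l+1\<^esub>) = 0\<close>.
\<close>

lemma node_gradients_cancel:
  assumes \<kappa>: "1 \<le> \<kappa>" and p: "0 < p"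
  shows "(\<Sum>i\<in>{1..p + 2}. node_gradient p \<kappa> i (geometric (rate1 \<kappa>))) = 0"
proof (rule ell2_eqI)
  fix l
  define q where "q = rate1 \<kappa>"
  define \<gamma> where "\<gamma> = (\<kappa> - 1) / 2"
  have q: "0 \<le> q" "q < 1" and eq: "\<gamma> * (1 - q)\<^sup>2 = 3 * q"
    using rate1_bounds[OF \<kappa>] rate1_equation[OF \<kappa>] by (simp_all add: q_def \<gamma>_def)
  have nth: "ell2_nth (geometric q) l' = q ^ l'" for l'
    using q by (simp add: geometric.rep_eq)
  have "node_gradient p \<kappa> i x = (1 / real p) *\<^sub>R x" if "i \<in> {3..p + 2}" for i x
    using that by (simp add: node_gradient_def pair_gradient_def node_convexity_def
        node_coupling_def node_linear_def)
  then have rest: "(\<Sum>i\<in>{3..p + 2}. node_gradient p \<kappa> i x) = x" for x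
    using p by (simp add: sum_constant_scaleR)
  have "ell2_nth (\<Sum>i\<in>{1..p + 2}. node_gradient p \<kappa> i (geometric q)) l =
      3 * q ^ l + \<gamma> * (2 * q ^ l - q ^ odd_pairs l - q ^ even_pairs l)
        - (3 + \<gamma> * (1 - q)) * ell2_nth unit0 l"
    unfolding sum_nodes rest using bij_node_pairs[of 1] bij_node_pairs[of 2]
    by (simp add: node_gradient_def pair_gradient_def node_convexity_def
        node_coupling_def node_linear_def node_pairs_def ell2_nth_simps permute.rep_eq nth
        q_def[symmetric] \<gamma>_def[symmetric] right_diff_distrib)
  also have "\<dots> = 0"
  proof (cases l)
    case 0
    then show ?thesis
      by (simp add: odd_pairs_def even_pairs_def unit0.rep_eq algebra_simps)
  next
    case (Suc l')
    have "q ^ odd_pairs l + q ^ even_pairs l = q ^ l' + q ^ Suc (Suc l')"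
      using Suc by (auto simp: odd_pairs_def even_pairs_def)
    then have "3 * q ^ l + \<gamma> * (2 * q ^ l - q ^ odd_pairs l - q ^ even_pairs l)
        = 3 * q ^ l + \<gamma> * (2 * q ^ l - (q ^ l' + q ^ Suc (Suc l')))"
      by (simp add: algebra_simps)
    also have "\<dots> = q ^ l' * (3 * q - \<gamma> * (1 - q)\<^sup>2)"
      using Suc by (simp add: power2_eq_square algebra_simps)
    finally show ?thesis using Suc eq by (simp add: unit0.rep_eq)
  qed
  finally show "ell2_nth (\<Sum>i\<in>{1..p + 2}. node_gradient p \<kappa> i (geometric (rate1 \<kappa>))) l
      = ell2_nth 0 l"
    by (simp add: q_def ell2_nth_simps)
qed

lemma geometric_minimizes:
  assumes \<kappa>: "1 \<le> \<kappa>" and p: "0 < p"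
  shows "(\<Sum>i\<in>{1..p + 2}. node_energy p \<kappa> i (geometric (rate1 \<kappa>)))
    \<le> (\<Sum>i\<in>{1..p + 2}. node_energy p \<kappa> i y)"
proof -
  let ?x = "geometric (rate1 \<kappa>)"
  have "node_energy p \<kappa> i ?x + inner (node_gradient p \<kappa> i ?x) (y - ?x) \<le> node_energy p \<kappa> i y"
    for i
  proof -
    have "0 \<le> node_convexity p i / 2 * (norm (y - ?x))\<^sup>2" by (simp add: node_convexity_def)
    then show ?thesis
      using quadratically_boundedD(1)[OF quadratically_bounded_node_energy[OF \<kappa>, of p i], of ?x y]
      by linarith
  qed
  then have "(\<Sum>i\<in>{1..p + 2}. node_energy p \<kappa> i ?x + inner (node_gradient p \<kappa> i ?x) (y - ?x))
      \<le> (\<Sum>i\<in>{1..p + 2}. node_energy p \<kappa> i y)"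
    by (rule sum_mono)
  moreover have "(\<Sum>i\<in>{1..p + 2}. inner (node_gradient p \<kappa> i ?x) (y - ?x)) = 0"
    by (simp only: inner_sum_left[symmetric] node_gradients_cancel[OF assms] inner_zero_left)
  ultimately show ?thesis by (simp only: sum.distrib)
qed

lemma is_arg_min_geometric:
  assumes "1 \<le> \<kappa>" "0 < p"
  shows "is_arg_min (\<lambda>x. \<Sum>i\<in>{1..p + 2}. local_objective (summand p \<kappa> i :: 'n::finite \<Rightarrow> _) x)
    (\<lambda>_. True) (\<chi> j. geometric (rate1 \<kappa>))"
proof -
  have "(\<Sum>i\<in>{1..p + 2}. local_objective (summand p \<kappa> i :: 'n \<Rightarrow> _) x) =
      (\<Sum>j\<in>UNIV. \<Sum>i\<in>{1..p + 2}. node_energy p \<kappa> i (x $ j))" for x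
    unfolding local_objective_summand by (rule sum.swap)
  then show ?thesis
    unfolding is_arg_min_linorder using geometric_minimizes[OF assms]
    by (simp only: vec_lambda_beta) (blast intro: sum_mono)
qed

section \<open>How memories grow\<close>

definition supported :: "('n::finite \<Rightarrow> nat) \<Rightarrow> (ell2 ^ 'n) set"
  where "supported k = {x. \<forall>j l. k j \<le> l \<longrightarrow> ell2_nth (x $ j) l = 0}"

lemma subspace_supported: "subspace (supported k)"
  by (rule subspaceI) (auto simp: supported_def ell2_nth_simps)

lemma supported_mono: "(\<And>j. k j \<le> k' j) \<Longrightarrow> supported k \<subseteq> supported k'"
  unfolding supported_def by (blast intro: order_trans)

definition flip_blocks :: "('n::finite \<Rightarrow> nat) \<Rightarrow> ell2 ^ 'n \<Rightarrow> ell2 ^ 'n"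
  where "flip_blocks k x = (\<chi> j. flip_from (k j) (x $ j))"

lemma reflection_flip_blocks: "reflection (flip_blocks k)"
proof -
  have flip: "linear (flip_from l)" "flip_from l (flip_from l y) = y"
    "inner (flip_from l y) z = inner y (flip_from l z)" for l y z
    using reflection_flip_from by (auto simp: reflection_def)
  have "linear (flip_blocks k)"
    by (rule linearI) (simp_all add: flip_blocks_def vec_eq_iff linear_add[OF flip(1)]
        linear_scale[OF flip(1)])
  moreover have "flip_blocks k (flip_blocks k x) = x" for x
    by (simp add: flip_blocks_def vec_eq_iff flip(2))
  moreover have "inner (flip_blocks k x) y = inner x (flip_blocks k y)" for x y
    by (simp add: flip_blocks_def inner_vec_def flip(3))
  ultimately show ?thesis by (simp add: reflection_def)
qed

lemma flip_blocks_fixed_iff: "flip_blocks k x = x \<longleftrightarrow> x \<in> supported k"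
proof -
  have "flip_from l y = y \<longleftrightarrow> (\<forall>l'\<ge>l. ell2_nth y l' = 0)" for l y
    by (auto simp: ell2_nth_inject[symmetric] fun_eq_iff flip_from.rep_eq)
  then show ?thesis by (auto simp: flip_blocks_def vec_eq_iff supported_def)
qed

text \<open>
  In this case the cut before coordinate \<open>k\<close> separates no pair of node \<open>i\<close>, so the node cannot carry information
  across it. For node 1, oddness also excludes \<open>k = 0\<close>: its linear term reveals coordinate 0.
\<close>

definition blocked :: "nat \<Rightarrow> nat \<Rightarrow> bool"
  where "blocked i k \<longleftrightarrow> (i = 1 \<longrightarrow> odd k) \<and> (i = 2 \<longrightarrow> even k)"

lemma blocked_pairs: "blocked i k \<Longrightarrow> node_pairs i l < k \<longleftrightarrow> l < k"
  by (auto simp: blocked_def node_pairs_def odd_pairs_def even_pairs_def; presburger)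

text \<open>
  Flipping the sign of all coordinates beyond the cut is a symmetry of the summand, and the
  fixed points of this reflection are the supported vectors.
\<close>

lemma oracle_answer_blocked:
  assumes x: "x \<in> supported k" and k: "blocked i (k j)"
    and d: "d \<in> oracle_answer (summand p \<kappa> i) (q, j, x)"
  shows "d \<in> supported k"
proof -
  have "node_linear \<kappa> i = 0 \<or> 0 < k j"
    using k by (auto simp: blocked_def node_linear_def odd_pos)
  then have "summand p \<kappa> i j (flip_blocks k y) = summand p \<kappa> i j y" for y
    using pair_energy_flip_from[OF bij_node_pairs blocked_pairs[OF k]]
    by (simp add: summand_def flip_blocks_def node_energy_def)
  then have "flip_blocks k d = d"
    using oracle_answer_reflection_fixed[OF reflection_flip_blocks _ _ d] x
    by (simp add: flip_blocks_fixed_iff)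
  then show ?thesis by (simp add: flip_blocks_fixed_iff)
qed

text \<open>Of two consecutive levels, one is blocked, so a call advances its block by at most 1.\<close>

lemma oracle_answer_advance:
  assumes x: "x \<in> supported k" and d: "d \<in> oracle_answer (summand p \<kappa> i) (q, j, x)"
    and k': "\<And>j'. k j' \<le> k' j'" "i = 1 \<or> i = 2 \<Longrightarrow> Suc (k j) \<le> k' j"
  shows "d \<in> supported k'"
proof (cases "blocked i (k j)")
  case True
  then show ?thesis using oracle_answer_blocked[OF x _ d] supported_mono k'(1) by blast
next
  case False
  let ?k = "k(j := Suc (k j))"
  have i: "i = 1 \<or> i = 2" using False by (auto simp: blocked_def)
  have "blocked i (?k j)" using False by (auto simp: blocked_def)
  moreover have "supported k \<subseteq> supported ?k" by (rule supported_mono) simp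
  then have "x \<in> supported ?k" using x by blast
  ultimately have "d \<in> supported ?k" by (rule oracle_answer_blocked[rotated, OF _ d])
  moreover have "supported ?k \<subseteq> supported k'" using k' i by (intro supported_mono) auto
  ultimately show ?thesis by blast
qed

lemma communications_Suc:
  "communications comm (Suc t) = communications comm t + (if comm t then 1 else 0)"
proof -
  have "{s. s < Suc t \<and> comm s} = {s. s < t \<and> comm s} \<union> (if comm t then {t} else {})"
    by (auto simp: less_Suc_eq)
  then show ?thesis by (auto simp: communications_def)
qed

lemma communication_step:
  assumes run: "first_order_decentralized m G f K comm Q H"
    and t: "t < K" "comm t" and i: "i \<in> {1..m}"
  shows "H i (Suc t) \<subseteq>
    span ((\<Union>j\<in>{j. (i, j) \<in> parcs (G (Suc (communications comm t)))}. H j t) \<union> H i t)"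
  using run[unfolded first_order_decentralized_def, THEN conjunct2, rule_format, OF t(1) i] t(2)
  by (simp only: if_True)

lemma computation_step:
  assumes run: "first_order_decentralized m G f K comm Q H"
    and t: "t < K" "\<not> comm t" and i: "i \<in> {1..m}"
  shows "\<forall>(q, j, x)\<in>Q i t. x \<in> H i t"
    and "H i (Suc t) \<subseteq> span (H i t \<union> (\<Union>c\<in>Q i t. oracle_answer (f i) c))"
proof -
  have "(\<forall>(q, j, x)\<in>Q i t. x \<in> H i t) \<and>
      H i (Suc t) \<subseteq> span (H i t \<union> (\<Union>c\<in>Q i t. oracle_answer (f i) c))"
    by (rule run[unfolded first_order_decentralized_def, THEN conjunct2, THEN spec[of _ t],
        THEN mp, OF t(1), THEN bspec, OF i, unfolded if_not_P[OF t(2)]])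
  then show "\<forall>(q, j, x)\<in>Q i t. x \<in> H i t"
    "H i (Suc t) \<subseteq> span (H i t \<union> (\<Union>c\<in>Q i t. oracle_answer (f i) c))"
    by (rule conjunct1, rule conjunct2)
qed

lemma memory_level:
  assumes run: "first_order_decentralized (p + 2) (\<lambda>r. star (p + 2) (hub p r))
      (summand p \<kappa> :: nat \<Rightarrow> 'n::finite \<Rightarrow> _) K comm Q H"
    and p: "0 < p" and "t \<le> K" "i \<in> {1..p + 2}"
  shows "H i t \<subseteq> supported (\<lambda>_. level p i (communications comm t))"
  using \<open>t \<le> K\<close> \<open>i \<in> {1..p + 2}\<close>
proof (induction t arbitrary: i)
  case 0
  then show ?case
    using run subspace_0[OF subspace_supported] by (auto simp: first_order_decentralized_def)
next
  case (Suc t)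
  let ?r = "communications comm t"
  let ?S = "supported (\<lambda>_::'n. level p i (communications comm (Suc t)))"
  have IH: "H j t \<subseteq> supported (\<lambda>_. level p j ?r)" if "j \<in> {1..p + 2}" for j
    using Suc.IH[OF _ that] Suc.prems by simp
  show ?case
  proof (cases "comm t")
    case True
    have "H j t \<subseteq> ?S" if j: "j = i \<or> (i, j) \<in> parcs (star (p + 2) (hub p (Suc ?r)))" for j
    proof -
      have "j \<in> {1..p + 2}" using j Suc.prems by (auto simp: star_def)
      moreover have "level p j ?r \<le> level p i (Suc ?r)"
        using p Suc.prems(2) j by (rule level_step)
      ultimately show ?thesis
        using IH[of j] True supported_mono[of "\<lambda>_. level p j ?r" "\<lambda>_. level p i (Suc ?r)"]
        by (simp add: communications_Suc) blast
    qed
    then have "span ((\<Union>j\<in>{j. (i, j) \<in> parcs (star (p + 2) (hub p (Suc ?r)))}. H j t) \<union> H i t) \<subseteq> ?S"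
      by (intro span_minimal subspace_supported) auto
    moreover have "H i (Suc t) \<subseteq>
        span ((\<Union>j\<in>{j. (i, j) \<in> parcs (star (p + 2) (hub p (Suc ?r)))}. H j t) \<union> H i t)"
      using communication_step[OF run _ True Suc.prems(2)] Suc.prems(1) by simp
    ultimately show ?thesis by blast
  next
    case False
    have S: "?S = supported (\<lambda>_. level p i ?r)" using False by (simp add: communications_Suc)
    have calls: "\<forall>(q, j, x)\<in>Q i t. x \<in> H i t"
      and H: "H i (Suc t) \<subseteq> span (H i t \<union> (\<Union>c\<in>Q i t. oracle_answer (summand p \<kappa> i) c))"
      using computation_step[OF run _ False Suc.prems(2)] Suc.prems(1) by simp_all
    have "blocked i (level p i ?r)" by (auto simp: blocked_def level_def)
    then have "oracle_answer (summand p \<kappa> i) c \<subseteq> ?S" if "c \<in> Q i t" for c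
      using that calls IH[OF Suc.prems(2)] oracle_answer_blocked[of _ "\<lambda>_. level p i ?r"]
      unfolding S by (cases c) blast
    then have "span (H i t \<union> (\<Union>c\<in>Q i t. oracle_answer (summand p \<kappa> i) c)) \<subseteq> ?S"
      using IH[OF Suc.prems(2)] by (intro span_minimal subspace_supported) (auto simp: S)
    then show ?thesis using H by blast
  qed
qed

lemma enat_card_le_ecard: "J \<subseteq> g ` A \<Longrightarrow> enat (card J) \<le> ecard A"
  by (auto simp: ecard_def intro: surj_card_le)

text \<open>
  Only calls on nodes 1 and 2 advance a block, and all calls for one block within the same
  step advance it by at most 1, as they are made at points of the memory before that step.
\<close>

lemma memory_calls:
  assumes run: "first_order_decentralized m G
      (summand p \<kappa> :: nat \<Rightarrow> 'n::finite \<Rightarrow> _) K comm Q H"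
    and G: "\<And>r i j. 1 \<le> r \<Longrightarrow> (i, j) \<in> parcs (G r) \<Longrightarrow> j \<in> {1..m}"
    and "t \<le> K"
  shows "\<exists>k. (\<forall>i\<in>{1..m}. H i t \<subseteq> supported k) \<and>
    enat (\<Sum>j\<in>UNIV. k j) \<le> (\<Sum>s | s < t \<and> \<not> comm s. ecard (Q 1 s) + ecard (Q 2 s))"
  using \<open>t \<le> K\<close>
proof (induction t)
  case 0
  show ?case
    using run subspace_0[OF subspace_supported]
    by (intro exI[of _ "\<lambda>_. 0"]) (auto simp: first_order_decentralized_def zero_enat_def)
next
  case (Suc t)
  let ?total = "\<lambda>t. \<Sum>s | s < t \<and> \<not> comm s. ecard (Q 1 s) + ecard (Q 2 s)"
  obtain k where k: "\<And>i. i \<in> {1..m} \<Longrightarrow> H i t \<subseteq> supported k"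
    and total: "enat (\<Sum>j\<in>UNIV. k j) \<le> ?total t"
    using Suc.IH Suc.prems by (meson Suc_leD)
  show ?case
  proof (cases "comm t")
    case True
    have "H i (Suc t) \<subseteq> supported k" if i: "i \<in> {1..m}" for i
    proof -
      have "H i (Suc t) \<subseteq>
          span ((\<Union>j\<in>{j. (i, j) \<in> parcs (G (Suc (communications comm t)))}. H j t) \<union> H i t)"
        using communication_step[OF run _ True i] Suc.prems by simp
      moreover have "\<dots> \<subseteq> supported k"
        using k i G by (intro span_minimal subspace_supported) fastforce
      ultimately show ?thesis by blast
    qed
    moreover have "{s. s < Suc t \<and> \<not> comm s} = {s. s < t \<and> \<not> comm s}"
      using True less_Suc_eq by auto
    ultimately show ?thesis using total by (intro exI[of _ k]) auto
  next
    case False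
    define called where "called = (\<lambda>c. fst (snd c)) ` (Q 1 t \<union> Q 2 t)"
    define k' where "k' j = k j + (if j \<in> called then 1 else 0)" for j
    have "H i (Suc t) \<subseteq> supported k'" if i: "i \<in> {1..m}" for i
    proof -
      have calls: "\<forall>(q, j, x)\<in>Q i t. x \<in> H i t"
        and H: "H i (Suc t) \<subseteq> span (H i t \<union> (\<Union>c\<in>Q i t. oracle_answer (summand p \<kappa> i) c))"
        using computation_step[OF run _ False i] Suc.prems by simp_all
      have "oracle_answer (summand p \<kappa> i) c \<subseteq> supported k'" if c: "c \<in> Q i t" for c
      proof
        fix d
        assume d: "d \<in> oracle_answer (summand p \<kappa> i) c"
        obtain q j x where c': "c = (q, j, x)" by (cases c)
        have x: "x \<in> supported k" using calls c c' k[OF i] by auto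
        have "j \<in> called" if "i = 1 \<or> i = 2"
          using that c c' by (force simp: called_def)
        then show "d \<in> supported k'"
          using oracle_answer_advance[OF x d[unfolded c']] by (auto simp: k'_def)
      qed
      moreover have "supported k \<subseteq> supported k'" by (rule supported_mono) (simp add: k'_def)
      ultimately have "span (H i t \<union> (\<Union>c\<in>Q i t. oracle_answer (summand p \<kappa> i) c)) \<subseteq> supported k'"
        using k[OF i] by (intro span_minimal subspace_supported) blast
      then show ?thesis using H by blast
    qed
    moreover have "enat (\<Sum>j\<in>UNIV. k' j) \<le> ?total (Suc t)"
    proof -
      let ?J = "\<lambda>i. (\<lambda>c. fst (snd c)) ` Q i t"
      have "(\<Sum>j\<in>UNIV. k' j) = (\<Sum>j\<in>UNIV. k j) + card called"
        by (simp add: k'_def sum.distrib flip: sum.inter_filter[where P = "\<lambda>j. j \<in> called"])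
      also have "card called \<le> card (?J 1) + card (?J 2)"
        unfolding called_def image_Un by (rule card_Un_le)
      finally have "enat (\<Sum>j\<in>UNIV. k' j)
          \<le> enat (\<Sum>j\<in>UNIV. k j) + (enat (card (?J 1)) + enat (card (?J 2)))"
        by simp
      also have "\<dots> \<le> ?total t + (ecard (Q 1 t) + ecard (Q 2 t))"
        by (intro add_mono total enat_card_le_ecard) auto
      also have "\<dots> = ?total (Suc t)"
      proof -
        have "{s. s < Suc t \<and> \<not> comm s} = insert t {s. s < t \<and> \<not> comm s}"
          using False less_Suc_eq by auto
        then show ?thesis by (simp add: add.commute)
      qed
      finally show ?thesis .
    qed
    ultimately show ?thesis by blast
  qed
qed

section \<open>The lower bounds\<close>

lemma mean_relative_error_ge:
  fixes x :: "nat \<Rightarrow> 'h::real_normed_vector ^ 'n"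
  assumes m: "1 \<le> m"
    and B: "\<And>i j. i \<in> {1..m} \<Longrightarrow> B j \<le> (norm (x i $ j - xs))\<^sup>2 / (norm (0 - xs))\<^sup>2"
  shows "1 / real CARD('n) * (\<Sum>j\<in>UNIV. B j) \<le> mean_relative_error m (\<lambda>_. 0) x xs"
proof -
  let ?err = "\<Sum>i\<in>{1..m}. \<Sum>j\<in>UNIV. (norm (x i $ j - xs))\<^sup>2 / (norm ((0 :: 'h ^ 'n) $ j - xs))\<^sup>2"
  have "real m * (\<Sum>j\<in>UNIV. B j) = (\<Sum>i\<in>{1..m}. \<Sum>j\<in>UNIV. B j)" by simp
  also have "\<dots> \<le> ?err"
    by (intro sum_mono) (use B in simp)
  finally have "1 / (real CARD('n) * real m) * (real m * (\<Sum>j\<in>UNIV. B j))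
      \<le> 1 / (real CARD('n) * real m) * ?err"
    by (rule mult_left_mono) simp
  then show ?thesis using m by (simp add: mean_relative_error_def)
qed

lemma powr_mean_le:
  fixes a :: "'n::finite \<Rightarrow> real"
  assumes "0 < q"
  shows "q powr ((\<Sum>j\<in>UNIV. a j) / real CARD('n)) \<le> 1 / real CARD('n) * (\<Sum>j\<in>UNIV. q powr a j)"
proof -
  have "exp (\<Sum>j\<in>UNIV. (1 / real CARD('n)) *\<^sub>R (a j * ln q))
      \<le> (\<Sum>j\<in>UNIV. 1 / real CARD('n) * exp (a j * ln q))"
    by (rule convex_on_sum[OF _ _ exp_convex]) auto
  then show ?thesis
    using assms by (simp add: powr_def sum_distrib_left sum_distrib_right sum_divide_distrib)
qed

lemma rate2_eq_rate1:
  assumes "0 < n"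
  shows "rate2 n (real n * \<kappa>) = rate1 \<kappa>"
proof -
  have "sqrt (real n) * sqrt (2 / 3 * (real n * \<kappa>) + real n / 3)
      = sqrt (real n * real n * (2 / 3 * \<kappa> + 1 / 3))"
    by (simp add: algebra_simps flip: real_sqrt_mult)
  also have "\<dots> = real n * sqrt (2 / 3 * \<kappa> + 1 / 3)"
    by (simp only: real_sqrt_mult) simp
  finally have "rate2 n (real n * \<kappa>) =
      1 - (real n * 2) / (real n * (sqrt (2 / 3 * \<kappa> + 1 / 3) + 1))"
    by (simp add: rate2_def distrib_left mult.commute)
  then show ?thesis using assms by (simp add: rate1_def)
qed

lemma bound1_le:
  assumes \<kappa>: "1 \<le> \<kappa>" and chi: "24 < chi" and p: "(chi - 24) / 8 \<le> real p"
    and k: "k \<le> Suc (r div p)"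
  shows "bound1 chi \<kappa> r \<le> rate1 \<kappa> ^ (2 * k)"
proof (cases "rate1 \<kappa> = 0")
  case True
  then show ?thesis by (simp add: bound1_def)
next
  case False
  then have q: "0 < rate1 \<kappa>" "rate1 \<kappa> \<le> 1" using rate1_bounds[OF \<kappa>] by auto
  have "real k \<le> 1 + real (r div p)" using k by linarith
  also have "\<dots> \<le> 1 + real r / real p" by (simp add: of_nat_div_le_of_nat)
  also have "\<dots> \<le> 1 + real r / ((chi - 24) / 8)"
    using p chi by (intro add_left_mono divide_left_mono) auto
  finally have "real (2 * k) \<le> 2 + 16 * real r / (chi - 24)" by simp
  then have "rate1 \<kappa> powr (2 + 16 * real r / (chi - 24)) \<le> rate1 \<kappa> powr real (2 * k)"
    using q by (intro powr_mono') auto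
  then show ?thesis unfolding bound1_def by (simp only: powr_realpow[OF q(1)])
qed

text \<open>
  However the calls are distributed over the blocks, the mean over the blocks is at
  least the value for an even distribution, by convexity of the exponential.
\<close>

lemma bound2_le:
  fixes k :: "'n::finite \<Rightarrow> nat"
  assumes \<kappa>: "1 \<le> \<kappa>" and k: "enat (\<Sum>j\<in>UNIV. k j) \<le> Ns + Ns"
  shows "bound2 CARD('n) (real CARD('n) * \<kappa>) Ns
    \<le> 1 / real CARD('n) * (\<Sum>j\<in>UNIV. rate1 \<kappa> ^ (2 * k j))"
proof -
  let ?q = "rate1 \<kappa>" and ?mean = "1 / real CARD('n) * (\<Sum>j\<in>UNIV. rate1 \<kappa> ^ (2 * k j))"
  have q: "0 \<le> ?q" "?q \<le> 1" using rate1_bounds[OF \<kappa>] by auto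
  have nonneg: "0 \<le> ?mean" using q by (simp add: sum_nonneg)
  show ?thesis
  proof (cases Ns)
    case infinity
    then show ?thesis using nonneg by (simp add: bound2_def)
  next
    case (enat s)
    have total: "(\<Sum>j\<in>UNIV. k j) \<le> 2 * s" using k enat by simp
    consider "s = 0" | "s \<noteq> 0" "?q = 0" | "s \<noteq> 0" "0 < ?q" using q by fastforce
    then show ?thesis
    proof cases
      case 1
      then have "k j = 0" for j using total by simp
      then show ?thesis using 1 enat by (simp add: bound2_def)
    next
      case 2
      then show ?thesis using nonneg enat by (simp add: bound2_def rate2_eq_rate1)
    next
      case 3
      have "real (\<Sum>j\<in>UNIV. k j) \<le> 2 * real s" using total by linarith
      then have "(\<Sum>j\<in>UNIV. real (2 * k j)) \<le> 4 * real s"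
        by (simp flip: sum_distrib_left)
      then have "?q powr (4 * real s / real CARD('n))
          \<le> ?q powr ((\<Sum>j\<in>UNIV. real (2 * k j)) / real CARD('n))"
        using 3 q by (intro powr_mono' divide_right_mono) auto
      also have "\<dots> \<le> 1 / real CARD('n) * (\<Sum>j\<in>UNIV. ?q powr real (2 * k j))"
        using 3 by (intro powr_mean_le)
      finally show ?thesis
        using 3 enat by (simp only: powr_realpow) (simp add: bound2_def rate2_eq_rate1)
    qed
  qed
qed

lemma oracle_calls_le_max:
  assumes "i \<in> {1..m}"
  shows "(\<Sum>s | s < K \<and> \<not> comm s. ecard (Q i s)) \<le> max_oracle_calls m K comm Q"
  unfolding max_oracle_calls_def using assms by (intro Max_ge) auto

theorem theorem5p3:
  fixes chi \<kappa>b :: real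
  assumes "chi > 24" and "\<kappa>b \<ge> 1"
  shows "\<exists>(\<kappa>s::real) (m::nat) (G :: nat \<Rightarrow> nat pair_pre_digraph) (W :: nat \<Rightarrow> nat \<Rightarrow> nat \<Rightarrow> real)
      (f :: nat \<Rightarrow> 'n::finite \<Rightarrow> ell2 ^ 'n \<Rightarrow> real).
    \<kappa>s > 0 \<and> m \<ge> 1 \<and>
    time_varying_network m G \<and>
    gossip_assumption TYPE(ell2 ^ 'n) chi m G W \<and>
    (\<exists>(L :: nat \<Rightarrow> real) (Lf :: nat \<Rightarrow> 'n \<Rightarrow> real) (\<mu> :: nat \<Rightarrow> real). \<forall>i\<in>{1..m}.
      (\<forall>j. convex_on UNIV (f i j) \<and> smooth_with (Lf i j) (f i j)) \<and>
      \<mu> i > 0 \<and> strongly_convex (\<mu> i) (local_objective (f i)) \<and>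
      smooth_with (L i) (local_objective (f i)) \<and>
      \<kappa>b \<ge> L i / \<mu> i \<and>
      \<kappa>s \<ge> 1 / real CARD('n) * (\<Sum>j\<in>UNIV. Lf i j / \<mu> i)) \<and>
    0 \<le> rate2 CARD('n) \<kappa>s \<and>
    (\<exists>xs :: ell2. xs \<noteq> 0 \<and>
      is_arg_min (\<lambda>x. \<Sum>i\<in>{1..m}. local_objective (f i) x) (\<lambda>_. True) (\<chi> j. xs) \<and>
      (\<forall>K comm Q H. first_order_decentralized m G f K comm Q H \<longrightarrow>
        (\<forall>x. (\<forall>i\<in>{1..m}. x i \<in> H i K) \<longrightarrow>
          mean_relative_error m (\<lambda>_. 0) x xs \<ge>
            max (bound1 chi \<kappa>b (communications comm K))
                (bound2 CARD('n) \<kappa>s (max_oracle_calls m K comm Q)))))"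
proof -
  \<comment> \<open>A phase of \<open>p\<close> rounds yields one coordinate, that is, two units of the exponent; the contraction
    of the star needs \<open>p + 2 \<le> chi\<close>.\<close>
  define p where "p = nat \<lceil>(chi - 24) / 8\<rceil>"
  have ceil: "0 < \<lceil>(chi - 24) / 8\<rceil>" using assms(1) by simp
  then have real_p: "real p = real_of_int \<lceil>(chi - 24) / 8\<rceil>" by (simp add: p_def)
  have p: "0 < p" "(chi - 24) / 8 \<le> real p" "real (p + 2) \<le> chi"
  proof -
    show "0 < p" using ceil by (simp add: p_def)
    show "(chi - 24) / 8 \<le> real p" by (simp add: real_p)
    have "real p < (chi - 24) / 8 + 1"
      unfolding real_p using ceiling_correct[of "(chi - 24) / 8"] by linarith
    then show "real (p + 2) \<le> chi" using assms(1) by (simp add: field_simps)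
  qed
  define G where "G r = star (p + 2) (hub p r)" for r
  define W where "W r = star_gossip (p + 2) (hub p r)" for r
  define f where "f = (summand p \<kappa>b :: nat \<Rightarrow> 'n \<Rightarrow> _)"
  define \<mu> where "\<mu> = node_convexity p"
  define L where "L i = \<mu> i + node_coupling \<kappa>b i" for i
  define xs where "xs = geometric (rate1 \<kappa>b)"
  have q: "0 \<le> rate1 \<kappa>b" "rate1 \<kappa>b < 1" by (rule rate1_bounds[OF assms(2)])+
  have hub: "hub p r \<in> {1..p + 2}" for r
    using p(1) by (simp add: hub_def Suc_le_eq)
  have "ell2_nth xs 0 = 1" using q by (simp add: xs_def geometric.rep_eq)
  then have xs: "xs \<noteq> 0" by (auto simp: ell2_nth_simps)
  have network: "time_varying_network (p + 2) G"
    unfolding time_varying_network_def G_def using pair_graph_star by (simp add: star_def)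
  have gossip: "gossip_assumption TYPE(ell2 ^ 'n) chi (p + 2) G W"
    unfolding G_def W_def using p(3) hub by (intro gossip_assumption_star) auto
  note regularity = summand_regularity(1-4)[where 'n = 'n, OF assms(2) p(1),
      folded \<mu>_def, folded L_def f_def]
    and constants = summand_regularity(5,6)[OF assms(2) p(1), folded \<mu>_def, folded L_def]
  have regular: "(\<forall>j. convex_on UNIV (f i j) \<and> smooth_with (real CARD('n) * L i) (f i j)) \<and>
      \<mu> i > 0 \<and> strongly_convex (\<mu> i) (local_objective (f i)) \<and>
      smooth_with (L i) (local_objective (f i)) \<and> \<kappa>b \<ge> L i / \<mu> i \<and>
      real CARD('n) * \<kappa>b \<ge> 1 / real CARD('n) * (\<Sum>j\<in>(UNIV :: 'n set). real CARD('n) * L i / \<mu> i)" for i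
  proof -
    have ratio: "L i / \<mu> i \<le> \<kappa>b" using constants[of i] by (simp add: divide_le_eq)
    have "1 / real CARD('n) * (\<Sum>j\<in>(UNIV :: 'n set). real CARD('n) * L i / \<mu> i)
        = real CARD('n) * (L i / \<mu> i)"
      by simp
    also have "\<dots> \<le> real CARD('n) * \<kappa>b"
      by (rule mult_left_mono[OF ratio]) simp
    finally show ?thesis using ratio regularity[of i] constants(1)[of i] by simp
  qed
  have bound: "max (bound1 chi \<kappa>b (communications comm K))
      (bound2 CARD('n) (real CARD('n) * \<kappa>b) (max_oracle_calls (p + 2) K comm Q))
      \<le> mean_relative_error (p + 2) (\<lambda>_. 0) x xs"
    if run: "first_order_decentralized (p + 2) G f K comm Q H"
      and x: "\<And>i. i \<in> {1..p + 2} \<Longrightarrow> x i \<in> H i K" for K comm Q H x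
  proof -
    have error: "rate1 \<kappa>b ^ (2 * k j) \<le> (norm (x i $ j - xs))\<^sup>2 / (norm (0 - xs))\<^sup>2"
      if "x i \<in> supported k" for i j k
      unfolding xs_def using that q by (intro relative_error_geometric) (auto simp: supported_def)
    have "bound1 chi \<kappa>b (communications comm K) \<le> (norm (x i $ j - xs))\<^sup>2 / (norm (0 - xs))\<^sup>2"
      if i: "i \<in> {1..p + 2}" for i j
    proof -
      let ?k = "level p i (communications comm K)"
      have "x i \<in> supported (\<lambda>_. ?k)"
        using memory_level[OF run[unfolded f_def G_def] p(1) order_refl i] x[OF i] by blast
      then have "rate1 \<kappa>b ^ (2 * ?k) \<le> (norm (x i $ j - xs))\<^sup>2 / (norm (0 - xs))\<^sup>2"
        by (rule error)
      moreover have "bound1 chi \<kappa>b (communications comm K) \<le> rate1 \<kappa>b ^ (2 * ?k)"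
        by (rule bound1_le[OF assms(2,1) p(2)]) (simp add: level_def)
      ultimately show ?thesis by linarith
    qed
    then have "1 / real CARD('n) * (\<Sum>j\<in>(UNIV :: 'n set). bound1 chi \<kappa>b (communications comm K))
        \<le> mean_relative_error (p + 2) (\<lambda>_. 0) x xs"
      by (intro mean_relative_error_ge) auto
    then have communication: "bound1 chi \<kappa>b (communications comm K)
        \<le> mean_relative_error (p + 2) (\<lambda>_. 0) x xs"
      by simp
    let ?N = "max_oracle_calls (p + 2) K comm Q"
    have "\<exists>k. (\<forall>i\<in>{1..p + 2}. H i K \<subseteq> supported k) \<and>
        enat (\<Sum>j\<in>UNIV. k j) \<le> (\<Sum>s | s < K \<and> \<not> comm s. ecard (Q 1 s) + ecard (Q 2 s))"
      by (rule memory_calls[OF run[unfolded f_def]]) (auto simp: G_def star_def)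
    then obtain k where k: "\<And>i. i \<in> {1..p + 2} \<Longrightarrow> H i K \<subseteq> supported k"
      and "enat (\<Sum>j\<in>UNIV. k j) \<le> (\<Sum>s | s < K \<and> \<not> comm s. ecard (Q 1 s) + ecard (Q 2 s))"
      by blast
    moreover have "(\<Sum>s | s < K \<and> \<not> comm s. ecard (Q 1 s) + ecard (Q 2 s)) \<le> ?N + ?N"
      unfolding sum.distrib by (intro add_mono oracle_calls_le_max) auto
    ultimately have "bound2 CARD('n) (real CARD('n) * \<kappa>b) ?N
        \<le> 1 / real CARD('n) * (\<Sum>j\<in>UNIV. rate1 \<kappa>b ^ (2 * k j))"
      by (intro bound2_le[OF assms(2)]) (rule order_trans)
    also have "\<dots> \<le> mean_relative_error (p + 2) (\<lambda>_. 0) x xs"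
      using x k error by (intro mean_relative_error_ge) (simp, blast)
    finally show ?thesis using communication by simp
  qed
  show ?thesis
  proof (intro exI conjI)
    show "0 < real CARD('n) * \<kappa>b" using assms(2) by simp
    show "1 \<le> p + 2" by simp
    show "time_varying_network (p + 2) G" by (rule network)
    show "gossip_assumption TYPE(ell2 ^ 'n) chi (p + 2) G W" by (rule gossip)
    show "\<forall>i\<in>{1..p + 2}. (\<forall>j. convex_on UNIV (f i j) \<and> smooth_with (real CARD('n) * L i) (f i j)) \<and>
      \<mu> i > 0 \<and> strongly_convex (\<mu> i) (local_objective (f i)) \<and>
      smooth_with (L i) (local_objective (f i)) \<and> \<kappa>b \<ge> L i / \<mu> i \<and>
      real CARD('n) * \<kappa>b \<ge> 1 / real CARD('n) * (\<Sum>j\<in>(UNIV :: 'n set). real CARD('n) * L i / \<mu> i)"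
      by (intro ballI regular)
    show "0 \<le> rate2 CARD('n) (real CARD('n) * \<kappa>b)" using q by (simp add: rate2_eq_rate1)
    show "xs \<noteq> 0" by (rule xs)
    show "is_arg_min (\<lambda>x. \<Sum>i\<in>{1..p + 2}. local_objective (f i) x) (\<lambda>_. True) (\<chi> j. xs)"
      unfolding f_def xs_def by (rule is_arg_min_geometric[OF assms(2) p(1)])
    show "\<forall>K comm Q H. first_order_decentralized (p + 2) G f K comm Q H \<longrightarrow>
        (\<forall>x. (\<forall>i\<in>{1..p + 2}. x i \<in> H i K) \<longrightarrow>
          mean_relative_error (p + 2) (\<lambda>_. 0) x xs \<ge>
            max (bound1 chi \<kappa>b (communications comm K))
                (bound2 CARD('n) (real CARD('n) * \<kappa>b) (max_oracle_calls (p + 2) K comm Q)))"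
      using bound by blast
  qed
qed

end
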